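(* For every integer $d\ge 1$, the set of all restricted shuffles is a generating subset of the group $\operatorname{Rec}_d$.
   Context: A rectangle in $\mathbb{R}^d$ is a set $\prod_{i=1}^d[a_i,b_i)$ with $a_i<b_i$ real numbers (a product of bounded left-closed right-open intervals). A multirectangle is a finite union of rectangles. For a multirectangle $M\subseteq\mathbb{R}^d$, $\operatorname{Rec}_d(M)$ denotes the group, under composition, of all bijections $f:M\to M$ for which there exists a finite partition of $M$ into rectangles such that the restriction of $f$ to each piece is a translation. We write $\operatorname{Rec}_d=\operatorname{Rec}_d([0,1)^d)$; $\operatorname{Rec}_1$ is the group $\operatorname{IET}$ of interval exchange transformations. Let $e_1,\dots,e_d$ be the standard basis of $\mathbb{R}^d$. A restricted shuffle (in direction $i$) in $\operatorname{Rec}_d(M)$ is defined as follows: take a rectangle $P=\prod_{j=1}^d[a_j,b_j)\subseteq M$, an index $i\in\{1,\dots,d\}$ and $c\in(a_i,b_i)$; let $P'$ (resp. $P''$) be the rectangle obtained from $P$ by replacing the factor $[a_i,b_i)$ by $[a_i,c)$ (resp. $[c,b_i)$). The restricted shuffle is the element of $\operatorname{Rec}_d(M)$ which is translation by $(b_i-c)e_i$ on $P'$, translation by $-(c-a_i)e_i$ on $P''$, and the identity outside $P$ (it exchanges the two adjacent rectangles $P'$ and $P''$). For $d=1$ these are the restricted rotations. *)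

theory Defs
  imports "HOL-Analysis.Analysis" "HOL-Algebra.Group" "HOL-Algebra.Generated_Groups"
begin

text \<open>Dimension d is encoded by the finite index type 'n (d = CARD('n) \<ge> 1).
  Points of R^d are elements of real^'n.\<close>

definition rect :: "real^'n \<Rightarrow> real^'n \<Rightarrow> (real^'n) set" where
  "rect a b = {x. \<forall>i. a$i \<le> x$i \<and> x$i < b$i}"

definition is_rectangle :: "(real^'n) set \<Rightarrow> bool" where
  "is_rectangle R \<longleftrightarrow> (\<exists>a b. (\<forall>i. a$i < b$i) \<and> R = rect a b)"

definition unit_cube :: "(real^'n) set" where
  "unit_cube = rect 0 1"

text \<open>Elements of Rec(M), represented as maps on the whole space that are the
  identity outside M (so that the group law is composition).\<close>
definition Rec_on :: "(real^'n) set \<Rightarrow> (real^'n \<Rightarrow> real^'n) set" where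
  "Rec_on M = {f. (\<forall>x. x \<notin> M \<longrightarrow> f x = x) \<and> bij_betw f M M \<and>
     (\<exists>P. finite P \<and> (\<forall>R\<in>P. is_rectangle R) \<and> disjoint P \<and> \<Union>P = M \<and>
          (\<forall>R\<in>P. \<exists>v. \<forall>x\<in>R. f x = x + v))}"

definition Rec_group :: "(real^'n) set \<Rightarrow> (real^'n \<Rightarrow> real^'n) monoid" where
  "Rec_group M = \<lparr>carrier = Rec_on M, mult = (\<circ>), one = id\<rparr>"

definition upd_vec :: "real^'n \<Rightarrow> 'n \<Rightarrow> real \<Rightarrow> real^'n" where
  "upd_vec v i c = (\<chi> j. if j = i then c else v$j)"

definition restricted_shuffle :: "real^'n \<Rightarrow> real^'n \<Rightarrow> 'n \<Rightarrow> real \<Rightarrow> real^'n \<Rightarrow> real^'n" where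
  "restricted_shuffle a b i c = (\<lambda>x.
     if x \<in> rect a (upd_vec b i c) then x + (b$i - c) *\<^sub>R axis i 1
     else if x \<in> rect (upd_vec a i c) b then x - (c - a$i) *\<^sub>R axis i 1
     else x)"

definition restricted_shuffles :: "(real^'n) set \<Rightarrow> (real^'n \<Rightarrow> real^'n) set" where
  "restricted_shuffles M = {restricted_shuffle a b i c | a b i c.
      (\<forall>j. a$j < b$j) \<and> rect a b \<subseteq> M \<and> a$i < c \<and> c < b$i}"

end

theory Submission
  imports Defs
begin

text \<open>Let f be a rectangle exchange and let C be the finite set of all coordinates of corners of its
  pieces and of their images. There is a finite set L of positive reals, linearly independent over
  the integers, such that every difference of elements of C is a sum of elements of L. Subdividing
  [0,1) at C into intervals with lengths in L gives a grid on the cube. The grid of a piece R,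
  carried along by f, need not be the grid of f(R); but on each axis both subdivide an interval of
  the same length, so by independence they use the same lengths with the same multiplicities, in
  another order. Hence a product of interval exchanges of the axes, performed inside f(R) and thus
  a product of restricted shuffles, turns one grid into the other. Doing this in all the pieces
  leaves a permutation of grid cells by translations, hence a product of swaps of two cells of
  equal shape, and such a swap is a product of shuffles, one coordinate being changed at a time.\<close>

section \<open>Positive integral bases of finite sets of reals\<close>

text \<open>A map that permutes the cells of a finite grid by translations has finite order. So for
  an f of infinite order, such as an irrational rotation of [0,1), no grid makes f itself a
  permutation of cells, however fine; hence the correction of f by shuffles inside the sets f(R).
  The correction needs the lengths on both sides to agree as multisets. A basis of the group
  generated by the differences of C would give equal coefficients, but coefficients of either sign
  do not count intervals: the lengths must be positive and every difference a combination with
  natural coefficients. Such an L comes from a subtractive Euclidean algorithm driven by an integral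
  relation, each run leaving fewer numbers. Combinations are sums of lists because a list of lengths
  is also a subdivision of an interval. The final swaps take place in a single grid, where cells of
  equal shape have equal or disjoint sides on each axis; this keeps the boxes met on the way
  disjoint.\<close>

definition word_sums :: "real set \<Rightarrow> real set" where
  "word_sums A = {sum_list w | w. set w \<subseteq> A}"

lemma word_sums_add: "s \<in> word_sums A \<Longrightarrow> t \<in> word_sums A \<Longrightarrow> s + t \<in> word_sums A"
  unfolding word_sums_def by (smt (verit) le_sup_iff mem_Collect_eq set_append sum_list.append)

lemma word_sums_incl: "a \<in> A \<Longrightarrow> a \<in> word_sums A"
  unfolding word_sums_def by (rule CollectI, rule exI[of _ "[a]"]) simp

lemma word_sums_trans:
  assumes "s \<in> word_sums A" "A \<subseteq> word_sums B"
  shows "s \<in> word_sums B"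
proof -
  obtain w where w: "s = sum_list w" "set w \<subseteq> A"
    using assms(1) by (auto simp: word_sums_def)
  have "sum_list w \<in> word_sums B" using w(2)
  proof (induction w)
    case Nil
    then show ?case by (auto simp: word_sums_def intro: exI[of _ "[]"])
  next
    case (Cons a w)
    then show ?case using assms(2) by (auto intro: word_sums_add)
  qed
  then show ?thesis using w by simp
qed

text \<open>Integer coefficients are the right ones here, since differences of multiplicities are to
  be compared. Meant for finite L: over an infinite set the sum is 0 by convention and the predicate
  fails.\<close>

definition int_independent :: "real set \<Rightarrow> bool" where
  "int_independent L \<longleftrightarrow> (\<forall>c :: real \<Rightarrow> int. (\<Sum>x\<in>L. c x * x) = 0 \<longrightarrow> (\<forall>x\<in>L. c x = 0))"

text \<open>The difference of the two multiplicity functions is an integral relation on L.\<close>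

lemma int_independent_mset_eq:
  assumes "int_independent L" "finite L" "set w \<subseteq> L" "set w' \<subseteq> L" "sum_list w = sum_list w'"
  shows "mset w = mset w'"
proof -
  define c where "c x = int (count (mset w) x) - int (count (mset w') x)" for x
  have *: "sum_list w = (\<Sum>x\<in>L. count (mset w) x * x)" if "set w \<subseteq> L" for w
    using that
  proof (induction w)
    case (Cons a w)
    have "(\<Sum>x\<in>L. count (mset (a # w)) x * x) = (\<Sum>x\<in>L. (if x = a then a else 0) + count (mset w) x * x)"
      by (intro sum.cong) (auto simp: algebra_simps)
    then show ?case using Cons \<open>finite L\<close> by (simp add: sum.distrib)
  qed simp
  have "(\<Sum>x\<in>L. c x * x) = 0"
    using *[OF assms(3)] *[OF assms(4)] assms(5)
    by (simp add: c_def left_diff_distrib sum_subtractf)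
  then have "\<forall>x\<in>L. c x = 0" using assms(1) by (auto simp: int_independent_def)
  then have "count (mset w) x = count (mset w') x" for x
    using assms(3,4) by (cases "x \<in> L") (auto simp: c_def, metis count_eq_zero_iff set_mset_mset subsetD)
  then show ?thesis by (rule multiset_eqI)
qed

text \<open>Keeps a linear relation valid when a Euclidean step changes only two of its
  terms.\<close>

lemma sum_modify_two:
  fixes f g :: "'a \<Rightarrow> real"
  assumes "finite I" "p \<in> I" "j \<in> I" "p \<noteq> j" "\<And>i. i \<in> I \<Longrightarrow> i \<noteq> p \<Longrightarrow> i \<noteq> j \<Longrightarrow> f i = g i"
    "f p + f j = g p + g j"
  shows "sum f I = sum g I"
proof -
  have "sum h I = h p + h j + sum h (I - {p} - {j})" for h :: "'a \<Rightarrow> real"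
    using assms by (simp add: sum.remove[of I p] sum.remove[of "I - {p}" j])
  moreover have "sum f (I - {p} - {j}) = sum g (I - {p} - {j})"
    using assms by (intro sum.cong) auto
  ultimately show ?thesis using assms(6) by simp
qed

text \<open>A Euclidean algorithm: subtracting the smaller of two numbers with coefficients of opposite
  sign from the larger one eventually makes two of them equal. Termination is lexicographic in
  the maximal absolute coefficient, its multiplicity and the number of negative coefficients.\<close>
lemma relation_reduce:
  fixes c :: "'a \<Rightarrow> int" and x :: "'a \<Rightarrow> real"
  assumes "finite I" "p \<in> I" "0 < c p" "\<And>i. i \<in> I \<Longrightarrow> \<bar>c i\<bar> \<le> c p"
    "\<And>i. i \<in> I \<Longrightarrow> 0 < x i" "(\<Sum>i\<in>I. c i * x i) = 0"
  shows "\<exists>I' x'. I' \<subset> I \<and> (\<forall>i\<in>I'. (0::real) < x' i) \<and> x ` I \<subseteq> word_sums (x' ` I')"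
  using assms(2-)
proof (induction "(nat (c p), card {i\<in>I. \<bar>c i\<bar> = c p}, card {i\<in>I. c i < 0})" arbitrary: c x p
    rule: wf_induct_rule[OF wf_lex_prod[OF wf_less_than wf_lex_prod[OF wf_less_than wf_less_than]]])
  case (1 c p x)
  note IH = "1.hyps" and p = "1.prems"(1,2) and le = "1.prems"(3) and pos = "1.prems"(4)
    and rel = "1.prems"(5)
  \<comment> \<open>The numbers are positive and c p > 0, so the zero sum forces a negative
    coefficient.\<close>
  have "\<exists>j\<in>I. c j < 0"
  proof (rule ccontr)
    assume "\<not> ?thesis"
    then have "\<And>i. i \<in> I \<Longrightarrow> 0 \<le> c i * x i" using pos
      by (metis less_eq_real_def mult_nonneg_nonneg not_less of_int_0_le_iff)
    then have "c p * x p \<le> 0" using rel p assms(1) member_le_sum[of p I "\<lambda>i. c i * x i"] by simp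
    then show False using p pos[of p] by (simp add: mult_le_0_iff)
  qed
  then obtain j where j: "j \<in> I" "c j < 0" by blast
  then have pj: "p \<noteq> j" using p by auto
  have cj: "- c j \<le> c p" using le[of j] j by simp
  consider "x p = x j" | "x p < x j" | "x j < x p" by linarith
  then show ?case
  proof cases
    case 1
    \<comment> \<open>Only the index j is dropped; its value survives at p. Working with a family
      instead of a set lets values coincide during the algorithm.\<close>
    have "x i \<in> x ` (I - {j})" if "i \<in> I" for i using 1 p pj that by (cases "i = j") (auto intro: image_eqI[of _ x p])
    then have "x ` I \<subseteq> x ` (I - {j})" by blast
    then have "x ` I \<subseteq> word_sums (x ` (I - {j}))" using word_sums_incl by blast
    then show ?thesis using j pos by (intro exI[of _ "I - {j}"] exI[of _ x]) auto
  next
    case 2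
    \<comment> \<open>Since c_p x_p + c_j x_j = (c_p + c_j) x_p + c_j (x_j - x_p), the number
      changes at j but the coefficient at p. The new coefficient lies in [0, c_p), so p no longer
      attains the old maximum.\<close>
    define x' where "x' = x(j := x j - x p)"
    define c' where "c' = c(p := c p + c j)"
    have pos': "\<And>i. i \<in> I \<Longrightarrow> 0 < x' i" using 2 pos by (auto simp: x'_def)
    have "(\<Sum>i\<in>I. c' i * x' i) = (\<Sum>i\<in>I. c i * x i)"
      using assms(1) p j pj by (intro sum_modify_two[of I p j]) (auto simp: x'_def c'_def algebra_simps)
    then have rel': "(\<Sum>i\<in>I. c' i * x' i) = 0" using rel by simp
    have c'le: "\<bar>c' i\<bar> \<le> c p" if "i \<in> I" for i using le[OF that] j cj p by (auto simp: c'_def)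
    define m where "m = Max ((\<lambda>i. \<bar>c' i\<bar>) ` I)"
    have mle: "\<bar>c' i\<bar> \<le> m" if "i \<in> I" for i using that assms(1) by (simp add: m_def)
    have "m \<in> (\<lambda>i. \<bar>c' i\<bar>) ` I" unfolding m_def using assms(1) j by (intro Max_in) auto
    then obtain q where q: "q \<in> I" "m = \<bar>c' q\<bar>" by blast
    have "\<bar>c' j\<bar> > 0" using j pj by (simp add: c'_def)
    then have m0: "m > 0" using mle[OF j(1)] by linarith
    \<comment> \<open>The new maximum may be attained at a negative coefficient; the sign makes it
      positive at q. This can create negative coefficients, but they are the last component of the
      measure and one of the first two drops.\<close>
    define \<sigma> where "\<sigma> = sgn (c' q)"
    have \<sigma>: "\<sigma> = 1 \<or> \<sigma> = -1" using m0 q by (auto simp: \<sigma>_def sgn_if)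
    define d where "d i = \<sigma> * c' i" for i
    have dq: "d q = m" using q by (simp add: d_def \<sigma>_def sgn_mult_abs abs_sgn mult.commute)
    have dabs: "\<bar>d i\<bar> = \<bar>c' i\<bar>" for i using \<sigma> by (auto simp: d_def)
    have "(\<Sum>i\<in>I. d i * x' i) = \<sigma> * (\<Sum>i\<in>I. c' i * x' i)"
      by (simp add: d_def sum_distrib_left mult.assoc)
    then have reld: "(\<Sum>i\<in>I. d i * x' i) = 0" using rel' by simp
    have "m \<le> c p" using c'le[OF q(1)] q by simp
    moreover have "card {i\<in>I. \<bar>d i\<bar> = d q} < card {i\<in>I. \<bar>c i\<bar> = c p}" if "m = c p"
    proof (rule psubset_card_mono)
      show "{i \<in> I. \<bar>d i\<bar> = d q} \<subset> {i \<in> I. \<bar>c i\<bar> = c p}"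
      proof
        show "{i \<in> I. \<bar>d i\<bar> = d q} \<subseteq> {i \<in> I. \<bar>c i\<bar> = c p}"
        proof
          fix i assume "i \<in> {i \<in> I. \<bar>d i\<bar> = d q}"
          then have i: "i \<in> I" "\<bar>c' i\<bar> = c p" by (simp_all add: dabs dq that)
          moreover have "i \<noteq> p" using i(2) p j cj by (auto simp: c'_def)
          ultimately show "i \<in> {i \<in> I. \<bar>c i\<bar> = c p}" by (simp add: c'_def)
        qed
        have "\<bar>d p\<bar> \<noteq> d q" "\<bar>c p\<bar> = c p" using p j cj by (simp_all add: dabs dq that c'_def)
        then show "{i \<in> I. \<bar>d i\<bar> = d q} \<noteq> {i \<in> I. \<bar>c i\<bar> = c p}" using p by blast
      qed
    qed (simp add: assms(1))
    ultimately have "((nat (d q), card {i\<in>I. \<bar>d i\<bar> = d q}, card {i\<in>I. d i < 0}),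
        (nat (c p), card {i\<in>I. \<bar>c i\<bar> = c p}, card {i\<in>I. c i < 0}))
        \<in> less_than <*lex*> less_than <*lex*> less_than"
      using m0 by (cases "m = c p") (simp_all add: dq)
    then have "\<exists>I' x''. I' \<subset> I \<and> (\<forall>i\<in>I'. (0::real) < x'' i) \<and> x' ` I \<subseteq> word_sums (x'' ` I')"
      using q(1) _ _ pos' reld by (rule IH) (use m0 mle in \<open>simp_all add: dq dabs\<close>)
    then obtain I' x'' where x'': "I' \<subset> I" "\<forall>i\<in>I'. (0::real) < x'' i" "x' ` I \<subseteq> word_sums (x'' ` I')"
      by blast
    have "x i \<in> word_sums (x' ` I)" if i: "i \<in> I" for i
    proof (cases "i = j")
      case True
      have "x' j + x' p \<in> word_sums (x' ` I)" using p j by (simp add: word_sums_add word_sums_incl)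
      then show ?thesis using True pj by (simp add: x'_def)
    next
      case False
      then have "x i = x' i" by (simp add: x'_def)
      then show ?thesis using i by (auto intro!: word_sums_incl)
    qed
    then have "x ` I \<subseteq> word_sums (x'' ` I')" using x''(3) word_sums_trans by blast
    then show ?thesis using x'' by blast
  next
    case 3
    \<comment> \<open>Here the coefficient of j becomes c_j + c_p, in [0, c_p): the maximum stays at
      p, its multiplicity does not grow, and one negative coefficient disappears.\<close>
    define x' where "x' = x(p := x p - x j)"
    define c' where "c' = c(j := c j + c p)"
    have pos': "\<And>i. i \<in> I \<Longrightarrow> 0 < x' i" using 3 pos by (auto simp: x'_def)
    have "(\<Sum>i\<in>I. c' i * x' i) = (\<Sum>i\<in>I. c i * x i)"
      using assms(1) p j pj by (intro sum_modify_two[of I p j]) (auto simp: x'_def c'_def algebra_simps)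
    then have rel': "(\<Sum>i\<in>I. c' i * x' i) = 0" using rel by simp
    have c'p: "c' p = c p" using pj by (simp add: c'_def)
    have c'le: "\<bar>c' i\<bar> \<le> c p" if "i \<in> I" for i using le[OF that] j cj p by (auto simp: c'_def)
    have "{i\<in>I. \<bar>c' i\<bar> = c p} \<subseteq> {i\<in>I. \<bar>c i\<bar> = c p}" using j cj by (auto simp: c'_def)
    then have "card {i\<in>I. \<bar>c' i\<bar> = c' p} \<le> card {i\<in>I. \<bar>c i\<bar> = c p}"
      using assms(1) by (auto intro!: card_mono simp: c'p)
    moreover have "card {i\<in>I. c' i < 0} < card {i\<in>I. c i < 0}"
    proof (rule psubset_card_mono)
      have "{i \<in> I. c' i < 0} \<subseteq> {i \<in> I. c i < 0}" "j \<notin> {i \<in> I. c' i < 0}"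
        using j cj by (auto simp: c'_def)
      then show "{i \<in> I. c' i < 0} \<subset> {i \<in> I. c i < 0}" using j by blast
    qed (simp add: assms(1))
    ultimately have "((nat (c' p), card {i\<in>I. \<bar>c' i\<bar> = c' p}, card {i\<in>I. c' i < 0}),
        (nat (c p), card {i\<in>I. \<bar>c i\<bar> = c p}, card {i\<in>I. c i < 0}))
        \<in> less_than <*lex*> less_than <*lex*> less_than"
      by (auto simp: c'p)
    then have "\<exists>I' x''. I' \<subset> I \<and> (\<forall>i\<in>I'. (0::real) < x'' i) \<and> x' ` I \<subseteq> word_sums (x'' ` I')"
      using p(1) _ _ pos' rel' by (rule IH) (use p c'le in \<open>simp_all add: c'p\<close>)
    then obtain I' x'' where x'': "I' \<subset> I" "\<forall>i\<in>I'. (0::real) < x'' i" "x' ` I \<subseteq> word_sums (x'' ` I')"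
      by blast
    have "x i \<in> word_sums (x' ` I)" if i: "i \<in> I" for i
    proof (cases "i = p")
      case True
      have "x' p + x' j \<in> word_sums (x' ` I)" using p j by (simp add: word_sums_add word_sums_incl)
      then show ?thesis using True pj by (simp add: x'_def)
    next
      case False
      then have "x i = x' i" by (simp add: x'_def)
      then show ?thesis using i by (auto intro!: word_sums_incl)
    qed
    then have "x ` I \<subseteq> word_sums (x'' ` I')" using x''(3) word_sums_trans by blast
    then show ?thesis using x'' by blast
  qed
qed

text \<open>An independent S serves as its own L. Otherwise a relation, with its sign chosen so that
  a coefficient of largest absolute value is positive, lets \<open>relation_reduce\<close> trade S
  for a smaller set whose sums still give all of S.\<close>

lemma ex_int_independent:
  assumes "finite S" "\<And>s. s \<in> S \<Longrightarrow> 0 < s"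
  shows "\<exists>L. finite L \<and> (\<forall>l\<in>L. 0 < l) \<and> int_independent L \<and> S \<subseteq> word_sums L"
  using assms
proof (induction "card S" arbitrary: S rule: less_induct)
  case less
  show ?case
  proof (cases "int_independent S")
    case True
    then show ?thesis using less.prems word_sums_incl by blast
  next
    case False
    then obtain c :: "real \<Rightarrow> int" and y where c: "(\<Sum>x\<in>S. c x * x) = 0" "y \<in> S" "c y \<noteq> 0"
      by (auto simp: int_independent_def)
    define m where "m = Max ((\<lambda>i. \<bar>c i\<bar>) ` S)"
    have mle: "\<bar>c i\<bar> \<le> m" if "i \<in> S" for i using that less.prems by (simp add: m_def)
    have "m \<in> (\<lambda>i. \<bar>c i\<bar>) ` S" unfolding m_def using less.prems c by (intro Max_in) auto
    then obtain q where q: "q \<in> S" "m = \<bar>c q\<bar>" by blast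
    have m0: "m > 0" using mle[OF c(2)] c by linarith
    define \<sigma> where "\<sigma> = sgn (c q)"
    have \<sigma>: "\<sigma> = 1 \<or> \<sigma> = -1" using m0 q by (auto simp: \<sigma>_def sgn_if)
    define d where "d i = \<sigma> * c i" for i
    have dq: "d q = m" using q by (simp add: d_def \<sigma>_def sgn_mult_abs abs_sgn mult.commute)
    have dabs: "\<bar>d i\<bar> = \<bar>c i\<bar>" for i using \<sigma> by (auto simp: d_def)
    have "(\<Sum>i\<in>S. d i * i) = \<sigma> * (\<Sum>i\<in>S. c i * i)"
      by (simp add: d_def sum_distrib_left mult.assoc)
    then have "(\<Sum>i\<in>S. d i * i) = 0" using c by simp
    then obtain I' x' where x': "I' \<subset> S" "\<forall>i\<in>I'. (0::real) < x' i" "S \<subseteq> word_sums (x' ` I')"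
      using relation_reduce[of S q d "\<lambda>x. x"] q m0 mle less.prems by (auto simp: dq dabs)
    have "card (x' ` I') < card S" using x'(1) less.prems(1)
      by (meson card_image_le finite_subset le_less_trans psubset_card_mono psubset_imp_subset)
    moreover have "finite (x' ` I')" using x'(1) less.prems(1) by (meson finite_imageI finite_subset psubset_imp_subset)
    ultimately obtain L where "finite L" "\<forall>l\<in>L. 0 < l" "int_independent L" "x' ` I' \<subseteq> word_sums L"
      using less.hyps[of "x' ` I'"] x'(2) by blast
    then show ?thesis using x'(3) word_sums_trans by (meson subset_iff)
  qed
qed

section \<open>Interval exchanges and subdivisions of an interval\<close>

text \<open>A tile is a left endpoint with a length, because tiles at different places are matched
  by length. Collecting them in a set makes "part of a subdivision" an inclusion.\<close>

fun tiles :: "real \<Rightarrow> real list \<Rightarrow> (real \<times> real) set" where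
  "tiles p [] = {}"
| "tiles p (l # w) = insert (p, l) (tiles (p + l) w)"

lemma finite_tiles: "finite (tiles p w)"
  by (induction w arbitrary: p) auto

lemma tiles_append: "tiles p (u @ w) = tiles p u \<union> tiles (p + sum_list u) w"
  by (induction u arbitrary: p) (auto simp: add.assoc)

lemma tiles_bounds:
  assumes "\<forall>l\<in>set w. 0 < l" "(s, l) \<in> tiles p w"
  shows "0 < l" "p \<le> s" "s + l \<le> p + sum_list w"
proof -
  have "0 < l \<and> p \<le> s \<and> s + l \<le> p + sum_list w"
    using assms
  proof (induction w arbitrary: p)
    case (Cons k w)
    have "0 \<le> sum_list w" using Cons.prems(1) by (intro sum_list_nonneg) auto
    then show ?case using Cons.prems Cons.IH[of "p + k"] by auto
  qed simp
  then show "0 < l" "p \<le> s" "s + l \<le> p + sum_list w" by auto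
qed

lemma tiles_cover:
  assumes "p \<le> x" "x < p + sum_list w"
  shows "\<exists>s l. (s, l) \<in> tiles p w \<and> s \<le> x \<and> x < s + l"
  using assms
proof (induction w arbitrary: p)
  case (Cons k w)
  show ?case
  proof (cases "x < p + k")
    case True
    then show ?thesis using Cons.prems by auto
  next
    case False
    then show ?thesis using Cons.prems Cons.IH[of "p + k"] by (auto simp: add.assoc)
  qed
qed simp

lemma tiles_unique:
  assumes "\<forall>l\<in>set w. 0 < l" "(s, l) \<in> tiles p w" "(s', l') \<in> tiles p w"
    "s \<le> x" "x < s + l" "s' \<le> x" "x < s' + l'"
  shows "s = s' \<and> l = l'"
  using assms
proof (induction w arbitrary: p)
  case (Cons k w)
  have pos: "\<forall>l\<in>set w. 0 < l" using Cons.prems by simp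
  note b = tiles_bounds(2)[OF pos, of _ _ "p + k"]
  show ?case
    using Cons.prems(2-) Cons.IH[OF pos, of "p + k"] b[of s l] b[of s' l'] by auto
qed simp

lemma tiles_shift: "(s, l) \<in> tiles p w \<Longrightarrow> (s + d, l) \<in> tiles (p + d) w"
proof (induction w arbitrary: p)
  case (Cons k w)
  then show ?case using Cons.IH[of "p + k"] by (auto simp: ac_simps)
qed simp

section \<open>Interval exchanges generated by rotations\<close>

definition rotation :: "real \<Rightarrow> real \<Rightarrow> real \<Rightarrow> real \<Rightarrow> real" where
  "rotation a c b x =
    (if a \<le> x \<and> x < c then x + (b - c) else if c \<le> x \<and> x < b then x - (c - a) else x)"

text \<open>The monoid generated by the rotations inside [p,q) is already a group, the inverse of
  \<open>rotation a c b\<close> being \<open>rotation a (a + b - c) b\<close>.\<close>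

inductive_set interval_exchanges :: "real \<Rightarrow> real \<Rightarrow> (real \<Rightarrow> real) set" for p q where
  id: "id \<in> interval_exchanges p q"
| rotation: "\<phi> \<in> interval_exchanges p q \<Longrightarrow> p \<le> a \<Longrightarrow> a < c \<Longrightarrow> c < b \<Longrightarrow> b \<le> q \<Longrightarrow>
    rotation a c b \<circ> \<phi> \<in> interval_exchanges p q"

lemma interval_exchanges_comp:
  "\<phi> \<in> interval_exchanges p q \<Longrightarrow> \<psi> \<in> interval_exchanges p q \<Longrightarrow> \<phi> \<circ> \<psi> \<in> interval_exchanges p q"
  by (induction rule: interval_exchanges.induct)
    (auto simp: comp_assoc intro: interval_exchanges.intros)

lemma interval_exchanges_mono:
  "\<phi> \<in> interval_exchanges p q \<Longrightarrow> p' \<le> p \<Longrightarrow> q \<le> q' \<Longrightarrow> \<phi> \<in> interval_exchanges p' q'"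
  by (induction rule: interval_exchanges.induct) (auto intro: interval_exchanges.intros)

lemma interval_exchanges_range:
  "\<phi> \<in> interval_exchanges p q \<Longrightarrow> p \<le> x \<Longrightarrow> x < q \<Longrightarrow> p \<le> \<phi> x \<and> \<phi> x < q"
  by (induction rule: interval_exchanges.induct) (auto simp: rotation_def)

lemma interval_exchanges_outside:
  "\<phi> \<in> interval_exchanges p q \<Longrightarrow> x < p \<or> q \<le> x \<Longrightarrow> \<phi> x = x"
  by (induction rule: interval_exchanges.induct) (auto simp: rotation_def)

lemma interval_exchanges_rotation:
  "p \<le> a \<Longrightarrow> a < c \<Longrightarrow> c < b \<Longrightarrow> b \<le> q \<Longrightarrow> rotation a c b \<in> interval_exchanges p q"
  using interval_exchanges.rotation[OF interval_exchanges.id] by simp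

text \<open>Insertion sort: one rotation moves a block of the length wanted first to the front, past
  the blocks u before it, and the blocks u and r are arranged to its right by induction.\<close>

lemma interval_exchanges_rearrange:
  assumes "mset w = mset w'" "\<forall>l\<in>set w. 0 < l"
  shows "\<exists>\<phi>\<in>interval_exchanges p (p + sum_list w).
    \<forall>(s, l)\<in>tiles p w. \<exists>t. (t, l) \<in> tiles p w' \<and> (\<forall>x. s \<le> x \<and> x < s + l \<longrightarrow> \<phi> x = x + (t - s))"
  using assms
proof (induction w' arbitrary: p w)
  case Nil
  then show ?case by (auto intro: interval_exchanges.id)
next
  case (Cons c w')
  from Cons.prems(1) have "c \<in> set w" by (metis list.set_intros(1) set_mset_mset)
  then obtain u r where w: "w = u @ c # r" by (meson split_list)
  let ?q = "p + sum_list w" and ?s = "sum_list u"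
  have pos: "\<forall>l\<in>set u. 0 < l" "\<forall>l\<in>set r. 0 < l" "0 < c" using Cons.prems(2) w by auto
  have s0: "0 \<le> ?s" and r0: "0 \<le> sum_list r" using pos by (auto intro!: sum_list_nonneg simp: less_imp_le)
  have q: "?q = p + c + sum_list (u @ r)" using w by simp
  obtain \<psi> where \<psi>: "\<psi> \<in> interval_exchanges (p + c) ?q"
    "\<forall>(s, l)\<in>tiles (p + c) (u @ r). \<exists>t. (t, l) \<in> tiles (p + c) w' \<and>
      (\<forall>x. s \<le> x \<and> x < s + l \<longrightarrow> \<psi> x = x + (t - s))"
    using Cons.IH[of "u @ r" "p + c"] Cons.prems w unfolding q by auto
  define \<rho> where "\<rho> = rotation p (p + ?s) (p + ?s + c)"
  have \<rho>: "\<rho> \<in> interval_exchanges p ?q"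
  \<comment> \<open>A block already in front gives a degenerate rotation, which is not among the
    generators but equals the identity.\<close>
  proof (cases "?s = 0")
    case True
    then have "\<rho> = id" by (auto simp: \<rho>_def rotation_def)
    then show ?thesis by (simp add: interval_exchanges.id)
  next
    case False
    then show ?thesis using s0 r0 pos w by (auto simp: \<rho>_def intro!: interval_exchanges_rotation)
  qed
  show ?case
  proof (intro bexI[of _ "\<psi> \<circ> \<rho>"] ballI)
    show "\<psi> \<circ> \<rho> \<in> interval_exchanges p ?q"
      using interval_exchanges_mono[OF \<psi>(1), of p ?q] \<rho> pos by (auto intro: interval_exchanges_comp)
  next
    fix sl assume "sl \<in> tiles p w"
    moreover obtain s l where sl: "sl = (s, l)" by (cases sl)
    ultimately consider (u) "(s, l) \<in> tiles p u" | (c) "s = p + ?s" "l = c" | (r) "(s, l) \<in> tiles (p + ?s + c) r"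
      by (auto simp: w tiles_append)
    then show "case sl of (s, l) \<Rightarrow> \<exists>t. (t, l) \<in> tiles p (c # w') \<and>
        (\<forall>x. s \<le> x \<and> x < s + l \<longrightarrow> (\<psi> \<circ> \<rho>) x = x + (t - s))"
      unfolding sl prod.case
    proof cases
      case u
      have b: "p \<le> s" "s + l \<le> p + ?s" using tiles_bounds[OF pos(1) u] by auto
      have "(s + c, l) \<in> tiles (p + c) (u @ r)" using tiles_shift[OF u] by (simp add: tiles_append)
      then obtain t where t: "(t, l) \<in> tiles (p + c) w'"
        "\<forall>x. s + c \<le> x \<and> x < s + c + l \<longrightarrow> \<psi> x = x + (t - (s + c))" using \<psi>(2) by blast
      have "\<rho> x = x + c" if "s \<le> x" "x < s + l" for x using that b by (auto simp: \<rho>_def rotation_def)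
      then show "\<exists>t. (t, l) \<in> tiles p (c # w') \<and> (\<forall>x. s \<le> x \<and> x < s + l \<longrightarrow> (\<psi> \<circ> \<rho>) x = x + (t - s))"
        using t by (intro exI[of _ t]) auto
    next
      case c
      have "\<rho> x = x - ?s" if "s \<le> x" "x < s + l" for x using that c by (auto simp: \<rho>_def rotation_def)
      moreover have "\<psi> (x - ?s) = x - ?s" if "s \<le> x" "x < s + l" for x
        using that c by (intro interval_exchanges_outside[OF \<psi>(1)]) auto
      ultimately show "\<exists>t. (t, l) \<in> tiles p (c # w') \<and> (\<forall>x. s \<le> x \<and> x < s + l \<longrightarrow> (\<psi> \<circ> \<rho>) x = x + (t - s))"
        using c by (intro exI[of _ p]) auto
    next
      case r
      have b: "p + ?s + c \<le> s" using tiles_bounds[OF pos(2) r] by auto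
      have "(s, l) \<in> tiles (p + c) (u @ r)" using r by (simp add: tiles_append ac_simps)
      then obtain t where t: "(t, l) \<in> tiles (p + c) w'"
        "\<forall>x. s \<le> x \<and> x < s + l \<longrightarrow> \<psi> x = x + (t - s)" using \<psi>(2) by blast
      have "\<rho> x = x" if "s \<le> x" "x < s + l" for x using that b s0 pos by (auto simp: \<rho>_def rotation_def)
      then show "\<exists>t. (t, l) \<in> tiles p (c # w') \<and> (\<forall>x. s \<le> x \<and> x < s + l \<longrightarrow> (\<psi> \<circ> \<rho>) x = x + (t - s))"
        using t by (intro exI[of _ t]) auto
    qed
  qed
qed

section \<open>Subdivisions through prescribed cuts\<close>

lemma ex_subdivision_aux:
  assumes "finite A" "\<forall>a\<in>A. p < a"
    "\<And>c d. c \<in> insert p A \<Longrightarrow> d \<in> insert p A \<Longrightarrow> c < d \<Longrightarrow> d - c \<in> word_sums L"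
  shows "\<exists>w. set w \<subseteq> L \<and> p + sum_list w \<in> insert p A \<and>
    (\<forall>c\<in>insert p A. \<exists>u v. w = u @ v \<and> p + sum_list u = c)"
  using assms
proof (induction A rule: finite_linorder_max_induct)
  case empty
  then show ?case by (intro exI[of _ "[]"]) auto
next
  case (insert b A)
  then obtain w where w: "set w \<subseteq> L" "p + sum_list w \<in> insert p A"
    "\<forall>c\<in>insert p A. \<exists>u v. w = u @ v \<and> p + sum_list u = c" by (metis insert_iff)
  \<comment> \<open>Cuts are added in increasing order and the word so far ends at one of them, so
    the gap up to b is a difference of two cuts.\<close>
  have "b - (p + sum_list w) \<in> word_sums L"
    using w(2) insert.hyps(2) insert.prems(1) by (intro insert.prems(2)) auto
  then obtain w' where w': "set w' \<subseteq> L" "sum_list w' = b - (p + sum_list w)"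
    by (auto simp: word_sums_def)
  have "\<exists>u v. w @ w' = u @ v \<and> p + sum_list u = c" if "c \<in> insert p (insert b A)" for c
  proof -
    from that consider "c = b" | "c \<in> insert p A" by blast
    then show "\<exists>u v. w @ w' = u @ v \<and> p + sum_list u = c"
    proof cases
      case 1
      then show ?thesis using w' by (intro exI[of _ "w @ w'"] exI[of _ "[]"]) auto
    next
      case 2
      then show ?thesis using w(3) by (metis append.assoc)
    qed
  qed
  then show ?case using w w' by (intro exI[of _ "w @ w'"]) auto
qed

text \<open>Every cut is the end of a prefix of one word. Of two prefixes of a word one extends the
  other; for c < d it is the prefix of d that is longer, the lengths being positive, and the factor
  in between subdivides [c,d).\<close>

lemma ex_subdivision:
  assumes "finite C" "p \<in> C" "\<forall>c\<in>C. p \<le> c" "\<forall>l\<in>L. 0 < l"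
    "\<And>c d. c \<in> C \<Longrightarrow> d \<in> C \<Longrightarrow> c < d \<Longrightarrow> d - c \<in> word_sums L"
  shows "\<exists>w. set w \<subseteq> L \<and> p + sum_list w \<in> C \<and>
    (\<forall>c\<in>C. \<forall>d\<in>C. c < d \<longrightarrow> (\<exists>m. set m \<subseteq> L \<and> c + sum_list m = d \<and> tiles c m \<subseteq> tiles p w))"
proof -
  have C: "insert p (C - {p}) = C" using assms(2) by blast
  have "\<exists>w. set w \<subseteq> L \<and> p + sum_list w \<in> insert p (C - {p}) \<and>
      (\<forall>c\<in>insert p (C - {p}). \<exists>u v. w = u @ v \<and> p + sum_list u = c)"
  proof (rule ex_subdivision_aux)
    show "\<forall>a\<in>C - {p}. p < a" using assms(3) by (auto simp: less_le)
  qed (use assms(1,2,5) in \<open>auto simp: C\<close>)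
  then obtain w where w: "set w \<subseteq> L" "p + sum_list w \<in> C"
    "\<forall>c\<in>C. \<exists>u v. w = u @ v \<and> p + sum_list u = c" unfolding C by blast
  have "\<exists>m. set m \<subseteq> L \<and> c + sum_list m = d \<and> tiles c m \<subseteq> tiles p w"
    if cd: "c \<in> C" "d \<in> C" "c < d" for c d
  proof -
    obtain u v where u: "w = u @ v" "p + sum_list u = c" using w(3) cd by blast
    obtain u' v' where u': "w = u' @ v'" "p + sum_list u' = d" using w(3) cd by blast
    from u(1) u'(1) consider m where "u' = u @ m" "v = m @ v'" | m where "u = u' @ m"
      by (metis append_eq_append_conv2)
    then show ?thesis
    proof cases
      case 1
      then have "tiles c m \<subseteq> tiles p w" using u by (auto simp: tiles_append)
      then show ?thesis using 1 u u' w(1) by (intro exI[of _ m]) auto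
    next
      case 2
      have "0 \<le> sum_list m" using 2 u(1) w(1) assms(4) by (intro sum_list_nonneg) (auto simp: less_imp_le subset_iff)
      then show ?thesis using 2 u u' cd by simp
    qed
  qed
  then show ?thesis using w by blast
qed

section \<open>Products of shuffles in the cube\<close>

lemma upd_vec_nth: "upd_vec v i c $ j = (if j = i then c else v $ j)"
  by (simp add: upd_vec_def)

lemma in_rect_iff: "x \<in> rect a b \<longleftrightarrow> (\<forall>i. a $ i \<le> x $ i \<and> x $ i < b $ i)"
  by (simp add: rect_def)

lemma in_rect_split:
  "x \<in> rect a b \<longleftrightarrow> (\<forall>j. j \<noteq> i \<longrightarrow> a $ j \<le> x $ j \<and> x $ j < b $ j) \<and> a $ i \<le> x $ i \<and> x $ i < b $ i"
  unfolding in_rect_iff by metis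

lemma in_rect_shift: "x \<in> rect (a + v) (b + v) \<longleftrightarrow> x - v \<in> rect a b"
  by (simp add: in_rect_iff le_diff_eq diff_less_eq)

lemma rect_subset_unit_cube_iff:
  assumes "\<forall>i. a $ i < b $ i"
  shows "rect a b \<subseteq> unit_cube \<longleftrightarrow> (\<forall>i. 0 \<le> a $ i \<and> b $ i \<le> 1)"
proof
  assume sub: "rect a b \<subseteq> unit_cube"
  show "\<forall>i. 0 \<le> a $ i \<and> b $ i \<le> 1"
  proof
    fix i
    have "a \<in> rect a b" using assms by (auto simp: in_rect_iff)
    then have "a \<in> unit_cube" using sub by blast
    then have "0 \<le> a $ i" by (simp add: unit_cube_def in_rect_iff)
    moreover have "b $ i \<le> 1"
    proof (rule ccontr)
      assume "\<not> b $ i \<le> 1"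
      \<comment> \<open>The corner a, raised in direction i to at least 1, is a point of the box
        outside the cube.\<close>
      then have "upd_vec a i (max 1 (a $ i)) \<in> rect a b" using assms by (auto simp: in_rect_iff upd_vec_nth)
      then have "upd_vec a i (max 1 (a $ i)) \<in> unit_cube" using sub by blast
      then have "upd_vec a i (max 1 (a $ i)) $ i < 1" unfolding unit_cube_def in_rect_iff by simp
      then show False by (simp add: upd_vec_nth)
    qed
    ultimately show "0 \<le> a $ i \<and> b $ i \<le> 1" ..
  qed
next
  assume "\<forall>i. 0 \<le> a $ i \<and> b $ i \<le> 1"
  then show "rect a b \<subseteq> unit_cube"
    by (auto simp: unit_cube_def in_rect_iff) (meson order_trans less_le_trans)+
qed

definition shuffle_group :: "(real^'n \<Rightarrow> real^'n) set" where
  "shuffle_group = generate (Rec_group unit_cube) (restricted_shuffles unit_cube)"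

lemma id_in_shuffle_group: "id \<in> shuffle_group"
  using generate.one[of "Rec_group unit_cube"] by (simp add: shuffle_group_def Rec_group_def)

lemma comp_in_shuffle_group:
  "f \<in> shuffle_group \<Longrightarrow> g \<in> shuffle_group \<Longrightarrow> f \<circ> g \<in> shuffle_group"
  using generate.eng[of f "Rec_group unit_cube" _ g] by (simp add: shuffle_group_def Rec_group_def)

section \<open>Interval exchanges of the coordinates of a box\<close>

definition slab_map :: "real^'n \<Rightarrow> real^'n \<Rightarrow> 'n \<Rightarrow> (real \<Rightarrow> real) \<Rightarrow> real^'n \<Rightarrow> real^'n" where
  "slab_map a b i \<phi> x = (if x \<in> rect a b then upd_vec x i (\<phi> (x $ i)) else x)"

text \<open>A rotation is the identity outside [p,q), so the shuffle lives on the box narrowed to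
  [p,q) in direction i.\<close>

lemma slab_map_rotation:
  assumes "a $ i \<le> p" "p < c" "c < q" "q \<le> b $ i"
  shows "slab_map a b i (rotation p c q) = restricted_shuffle (upd_vec a i p) (upd_vec b i q) i c"
proof
  fix x
  have "upd_vec x i (x $ i + t) = x + t *\<^sub>R axis i 1" "upd_vec x i (x $ i - t) = x - t *\<^sub>R axis i 1"
    "upd_vec x i (x $ i) = x" for t
    by (auto simp: vec_eq_iff upd_vec_nth axis_def)
  then show "slab_map a b i (rotation p c q) x = restricted_shuffle (upd_vec a i p) (upd_vec b i q) i c x"
    using assms
    by (auto simp: slab_map_def rotation_def restricted_shuffle_def upd_vec_nth in_rect_split[of x _ _ i])
qed

text \<open>An interval exchange of [a_i, b_i) keeps points in the box, so \<open>slab_map\<close>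
  turns compositions of rotations into compositions of shuffles.\<close>

lemma slab_map_in_shuffle_group:
  assumes "\<phi> \<in> interval_exchanges (a $ i) (b $ i)" "\<forall>j. a $ j < b $ j" "rect a b \<subseteq> unit_cube"
  shows "slab_map a b i \<phi> \<in> shuffle_group"
  using assms(1)
proof (induction rule: interval_exchanges.induct)
  case id
  have "slab_map a b i id = id" by (auto simp: slab_map_def vec_eq_iff upd_vec_nth)
  then show ?case using id_in_shuffle_group by metis
next
  case (rotation \<phi> p c q)
  have "upd_vec x i (\<phi> (x $ i)) \<in> rect a b" if "x \<in> rect a b" for x
    using that interval_exchanges_range[OF rotation.hyps(1)] by (auto simp: in_rect_iff upd_vec_nth)
  then have eq: "slab_map a b i (rotation p c q \<circ> \<phi>) = slab_map a b i (rotation p c q) \<circ> slab_map a b i \<phi>"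
    by (auto simp: slab_map_def fun_eq_iff vec_eq_iff upd_vec_nth)
  have "rect (upd_vec a i p) (upd_vec b i q) \<subseteq> rect a b"
    using rotation.hyps by (force simp: in_rect_split[of _ _ _ i] upd_vec_nth)
  then have "slab_map a b i (rotation p c q) \<in> restricted_shuffles unit_cube"
    unfolding slab_map_rotation[OF rotation.hyps(2-5)] restricted_shuffles_def
    using rotation.hyps assms(2,3)
    by (intro CollectI exI[of _ "upd_vec a i p"] exI[of _ "upd_vec b i q"] exI[of _ i] exI[of _ c])
      (auto simp: upd_vec_nth)
  then have "slab_map a b i (rotation p c q) \<in> shuffle_group"
    unfolding shuffle_group_def by (rule generate.incl)
  then show ?case unfolding eq using rotation.IH by (rule comp_in_shuffle_group)
qed

text \<open>A composition of slab maps, one per coordinate; each keeps points in the box, where the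
  next one acts.\<close>

lemma product_map_in_shuffle_group:
  assumes "\<And>i. \<phi> i \<in> interval_exchanges (a $ i) (b $ i)" "\<forall>j. a $ j < b $ j" "rect a b \<subseteq> unit_cube"
  shows "(\<lambda>x. if x \<in> rect a b then \<chi> i. \<phi> i (x $ i) else x) \<in> shuffle_group"
proof -
  have "(\<lambda>x. if x \<in> rect a b then \<chi> i. if i \<in> I then \<phi> i (x $ i) else x $ i else x) \<in> shuffle_group"
    (is "?F I \<in> _") for I
    using finite[of I]
  proof (induction I rule: finite_induct)
    case empty
    have "?F {} = id" by (auto simp: vec_eq_iff)
    then show ?case by (simp add: id_in_shuffle_group)
  next
    case (insert i I)
    have "(\<chi> i. if i \<in> I then \<phi> i (x $ i) else x $ i) \<in> rect a b" if "x \<in> rect a b" for x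
      using that interval_exchanges_range[OF assms(1)] by (auto simp: in_rect_iff)
    then have eq: "?F (insert i I) = slab_map a b i (\<phi> i) \<circ> ?F I"
      using insert.hyps by (auto simp: slab_map_def fun_eq_iff vec_eq_iff upd_vec_nth)
    show ?case
      unfolding eq using assms insert.IH by (intro comp_in_shuffle_group slab_map_in_shuffle_group)
  qed
  from this[of UNIV] show ?thesis by (simp cong: if_cong)
qed

section \<open>Exchanging a box with a disjoint translate\<close>

definition swap_map :: "real^'n \<Rightarrow> real^'n \<Rightarrow> real^'n \<Rightarrow> real^'n \<Rightarrow> real^'n" where
  "swap_map a b v x = (if x \<in> rect a b then x + v else if x - v \<in> rect a b then x - v else x)"

lemma rect_shift_disjoint:
  assumes "b $ i - a $ i \<le> \<bar>v $ i\<bar>" "x \<in> rect a b"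
  shows "x - v \<notin> rect a b"
proof
  assume "x - v \<in> rect a b"
  then have "a $ i \<le> (x - v) $ i" "(x - v) $ i < b $ i" unfolding in_rect_iff by blast+
  moreover have "a $ i \<le> x $ i" "x $ i < b $ i" using assms(2) unfolding in_rect_iff by blast+
  ultimately show False using assms(1) by simp
qed

text \<open>For disjoint boxes the order of the two tests in \<open>swap_map\<close> does not
  matter.\<close>

lemma swap_map_reverse:
  assumes "b $ i - a $ i \<le> \<bar>v $ i\<bar>"
  shows "swap_map a b v = swap_map (a + v) (b + v) (- v)"
proof
  fix x
  show "swap_map a b v x = swap_map (a + v) (b + v) (- v) x"
    using rect_shift_disjoint[of b i a v x, OF assms] by (simp add: swap_map_def in_rect_shift)
qed

lemma swap_map_involution:
  assumes "b $ i - a $ i \<le> \<bar>v $ i\<bar>"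
  shows "swap_map a b v (swap_map a b v x) = x"
  using rect_shift_disjoint[of b i a v x, OF assms] rect_shift_disjoint[of b i a v "x + v", OF assms]
  by (auto simp: swap_map_def)

text \<open>The identity (1 3) = (1 2)(2 3)(1 2) for the boxes B, B + u and B + u + w, where B is
  \<open>rect a b\<close>. The three hypotheses say that these are pairwise disjoint.\<close>

lemma swap_map_conjugate:
  assumes "\<And>x. x \<in> rect a b \<Longrightarrow> x - u \<notin> rect a b" "\<And>x. x \<in> rect a b \<Longrightarrow> x - w \<notin> rect a b"
    "\<And>x. x \<in> rect a b \<Longrightarrow> x - (u + w) \<notin> rect a b"
  shows "swap_map a b (u + w) = swap_map a b u \<circ> swap_map (a + u) (b + u) w \<circ> swap_map a b u"
proof
  fix x
  have s: "x + u + w - u = x + w" "x + (u + w) - u = x + w" "x - w - u = x - (u + w)" "x - u - w = x - (u + w)"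
    "x + u + w = x + (u + w)" "x - u - w - u = x - u - (u + w)" by simp_all
  consider "x \<in> rect a b" | "x - u \<in> rect a b" | "x - (u + w) \<in> rect a b"
    | "x \<notin> rect a b" "x - u \<notin> rect a b" "x - (u + w) \<notin> rect a b" by blast
  then show "swap_map a b (u + w) x = (swap_map a b u \<circ> swap_map (a + u) (b + u) w \<circ> swap_map a b u) x"
  proof cases
    case 1
    then show ?thesis using assms(1-3)[of x] assms(2)[of "x + w"] assms(3)[of "x + (u + w)"]
      by (auto simp: swap_map_def in_rect_shift s)
  next
    case 2
    then show ?thesis using assms(1)[of x] assms(1-3)[of "x - u"]
      by (auto simp: swap_map_def in_rect_shift s)
  next
    case 3
    then show ?thesis using assms(1)[of "x - w"] assms(2)[of "x - u"] assms(3)[of x]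
      by (auto simp: swap_map_def in_rect_shift s)
  next
    case 4
    then show ?thesis by (auto simp: swap_map_def in_rect_shift s)
  qed
qed

text \<open>Split [p,q) into blocks A, B, C, the outer ones of length l. One rotation turns ABC into
  CAB, a second one CAB into CBA; as A and C are equally long, B returns to its place. If t = l,
  then B is empty and one rotation is enough.\<close>

lemma swap_interval_exchange:
  assumes "0 < l" "l \<le> t" "q = p + t + l"
  shows "(\<lambda>x. if p \<le> x \<and> x < p + l then x + t else if p + t \<le> x \<and> x < q then x - t else x)
    \<in> interval_exchanges p q" (is "?\<phi> \<in> _")
proof (cases "t = l")
  case True
  then have "?\<phi> = rotation p (p + l) q" using assms by (auto simp: rotation_def fun_eq_iff)
  then show ?thesis using True assms by (auto intro!: interval_exchanges_rotation)
next
  case False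
  then have "?\<phi> = rotation (p + l) (p + 2 * l) q \<circ> rotation p (p + t) q"
    using assms by (auto simp: rotation_def fun_eq_iff)
  then show ?thesis using False assms
    by (auto intro!: interval_exchanges_rotation interval_exchanges_comp)
qed

text \<open>Inside the box spanned by the two boxes, the swap is an interval exchange of coordinate
  i alone.\<close>

lemma swap_map_axis_in_shuffle_group:
  assumes "\<forall>j. a $ j < b $ j" "rect a b \<subseteq> unit_cube" "v = t *\<^sub>R axis i 1"
    "rect (a + v) (b + v) \<subseteq> unit_cube" "b $ i - a $ i \<le> t"
  shows "swap_map a b v \<in> shuffle_group"
proof -
  let ?b = "b + v"
  have v: "v $ j = (if j = i then t else 0)" for j using assms(3) by (simp add: axis_def)
  have t0: "0 < t" using assms(1,5) by (metis diff_gt_0_iff_gt less_le_trans)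
  have ab: "\<forall>j. a $ j < ?b $ j"
  proof
    show "a $ j < ?b $ j" for j using assms(1)[rule_format, of j] t0 by (auto simp: v)
  qed
  have "\<forall>j. (a + v) $ j < ?b $ j" using assms(1) by simp
  then have "\<forall>j. ?b $ j \<le> 1" using assms(4) rect_subset_unit_cube_iff by blast
  moreover have "\<forall>j. 0 \<le> a $ j" using assms(1,2) rect_subset_unit_cube_iff by blast
  ultimately have sub: "rect a ?b \<subseteq> unit_cube" using ab by (simp add: rect_subset_unit_cube_iff)
  define \<phi> where "\<phi> = (\<lambda>x. if a $ i \<le> x \<and> x < a $ i + (b $ i - a $ i) then x + t
    else if a $ i + t \<le> x \<and> x < ?b $ i then x - t else x)"
  have "\<phi> \<in> interval_exchanges (a $ i) (?b $ i)"
    unfolding \<phi>_def using assms(1,5) by (intro swap_interval_exchange) (auto simp: v)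
  then have "slab_map a ?b i \<phi> \<in> shuffle_group" using ab sub by (rule slab_map_in_shuffle_group)
  moreover have "slab_map a ?b i \<phi> = swap_map a b v"
  proof
    fix x
    have "upd_vec x i (x $ i + t) = x + v" "upd_vec x i (x $ i - t) = x - v" "upd_vec x i (x $ i) = x"
      by (auto simp: vec_eq_iff upd_vec_nth v)
    then show "slab_map a ?b i \<phi> x = swap_map a b v x"
      using assms(5) t0
      by (auto simp: slab_map_def swap_map_def \<phi>_def v in_rect_split[of _ _ _ i])
  qed
  ultimately show ?thesis by simp
qed

text \<open>Boxes are moved one coordinate at a time; the intermediate boxes are pairwise disjoint
  because every nonzero coordinate of the displacement is at least the side length.\<close>
lemma swap_map_in_shuffle_group:
  assumes "\<forall>j. a $ j < b $ j" "rect a b \<subseteq> unit_cube" "rect (a + v) (b + v) \<subseteq> unit_cube"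
    "\<forall>i. v $ i = 0 \<or> b $ i - a $ i \<le> \<bar>v $ i\<bar>"
  shows "swap_map a b v \<in> shuffle_group"
  using assms
proof (induction "card {i. v $ i \<noteq> 0}" arbitrary: a b v rule: less_induct)
  case less
  show ?case
  proof (cases "v = 0")
    case True
    then have "swap_map a b v = id" by (auto simp: swap_map_def)
    then show ?thesis by (simp add: id_in_shuffle_group)
  next
    case False
    then obtain i where i: "v $ i \<noteq> 0" by (auto simp: vec_eq_iff)
    define u where "u = v $ i *\<^sub>R axis i (1::real)"
    define w where "w = v - u"
    have u: "u $ j = (if j = i then v $ i else 0)" for j by (simp add: u_def axis_def)
    have w: "w $ j = (if j = i then 0 else v $ j)" for j by (simp add: w_def u)
    have vuw: "v = u + w" by (simp add: w_def)
    have len: "b $ i - a $ i \<le> \<bar>v $ i\<bar>" using less.prems(4) i by blast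
    have bounds: "\<forall>j. 0 \<le> a $ j \<and> b $ j \<le> 1" "\<forall>j. 0 \<le> (a + v) $ j \<and> (b + v) $ j \<le> 1"
      using less.prems(1-3) by (simp_all add: rect_subset_unit_cube_iff)
    \<comment> \<open>On each axis the intermediate box has the side of the initial or of the final
      box.\<close>
    then have sub: "rect (a + u) (b + u) \<subseteq> unit_cube"
      using less.prems(1) by (simp add: rect_subset_unit_cube_iff u)
    have su: "swap_map a b u \<in> shuffle_group"
    proof (cases "0 < v $ i")
      case True
      then show ?thesis using less.prems len sub
        by (intro swap_map_axis_in_shuffle_group[of _ _ _ "v $ i" i]) (auto simp: u_def)
    next
      case False
      \<comment> \<open>Seen from the other box, the same swap has a positive displacement along the
        axis.\<close>
      have "swap_map (a + u) (b + u) (- u) \<in> shuffle_group"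
        using less.prems len sub False
        by (intro swap_map_axis_in_shuffle_group[of _ _ _ "- v $ i" i]) (auto simp: u_def)
      then show ?thesis using swap_map_reverse[of b i a u] len by (simp add: u)
    qed
    show ?thesis
    proof (cases "w = 0")
      case True
      then show ?thesis using su vuw by simp
    next
      case False
      then obtain k where k: "w $ k \<noteq> 0" by (auto simp: vec_eq_iff)
      then have lenk: "b $ k - a $ k \<le> \<bar>w $ k\<bar>" using less.prems(4) by (auto simp: w split: if_splits)
      have "{j. w $ j \<noteq> 0} \<subset> {j. v $ j \<noteq> 0}" using i by (auto simp: w)
      then have "card {j. w $ j \<noteq> 0} < card {j. v $ j \<noteq> 0}" by (intro psubset_card_mono) auto
      then have "swap_map (a + u) (b + u) w \<in> shuffle_group"
        using less.prems sub by (intro less.hyps) (simp_all add: w add.assoc flip: vuw)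
      moreover have "swap_map a b v = swap_map a b u \<circ> swap_map (a + u) (b + u) w \<circ> swap_map a b u"
        unfolding vuw
      proof (rule swap_map_conjugate)
        show "x - u \<notin> rect a b" if "x \<in> rect a b" for x
          using len that by (intro rect_shift_disjoint[of b i]) (auto simp: u)
        show "x - w \<notin> rect a b" if "x \<in> rect a b" for x
          using lenk that by (rule rect_shift_disjoint)
        show "x - (u + w) \<notin> rect a b" if "x \<in> rect a b" for x
          using len that unfolding vuw[symmetric] by (rule rect_shift_disjoint)
      qed
      ultimately show ?thesis using su by (simp add: comp_in_shuffle_group)
    qed
  qed
qed

section \<open>The group of rectangle exchanges\<close>

text \<open>The classes are the cells of the grid cut at C on every axis; testing
  \<open>c \<le> x $ i\<close> fits the half-open boxes. A map whose displacement is constant on the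
  classes is piecewise a translation.\<close>

definition same_side :: "real set \<Rightarrow> real^'n \<Rightarrow> real^'n \<Rightarrow> bool" where
  "same_side C x y \<longleftrightarrow> (\<forall>i. \<forall>c\<in>C. c \<le> x $ i \<longleftrightarrow> c \<le> y $ i)"

lemma same_side_unit_cube:
  assumes "same_side C x y" "0 \<in> C" "1 \<in> C" "x \<in> unit_cube"
  shows "y \<in> unit_cube"
  using assms unfolding same_side_def unit_cube_def in_rect_iff
  by (metis not_less one_index zero_index)

lemma same_side_rect:
  assumes "same_side C x y" "\<And>i. a $ i \<in> C" "\<And>i. b $ i \<in> C"
  shows "x \<in> rect a b \<longleftrightarrow> y \<in> rect a b"
  using assms unfolding same_side_def in_rect_iff by (metis not_less)

text \<open>On each axis the class runs from the largest cut below or at the coordinate to the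
  smallest cut above it; 0 and 1 in C ensure that both exist.\<close>

lemma same_side_class_is_rectangle:
  assumes "finite C" "0 \<in> C" "1 \<in> C" "x \<in> unit_cube"
  shows "is_rectangle {y \<in> unit_cube. same_side C x y}"
proof -
  define l where "l = (\<chi> i. Max {c\<in>C. c \<le> x $ i})"
  define u where "u = (\<chi> i. Min {c\<in>C. x $ i < c})"
  have x: "0 \<le> x $ i" "x $ i < 1" for i using assms(4) by (auto simp: unit_cube_def in_rect_iff)
  have "Max {c\<in>C. c \<le> x $ i} \<in> {c\<in>C. c \<le> x $ i}" for i using assms x[of i] by (intro Max_in) auto
  then have l: "l $ i \<in> C" "l $ i \<le> x $ i" for i by (auto simp: l_def)
  have "Min {c\<in>C. x $ i < c} \<in> {c\<in>C. x $ i < c}" for i using assms x[of i] by (intro Min_in) auto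
  then have u: "u $ i \<in> C" "x $ i < u $ i" for i by (auto simp: u_def)
  have lmax: "c \<le> l $ i" if "c \<in> C" "c \<le> x $ i" for c i
    using that assms(1) by (auto simp: l_def)
  have umin: "u $ i \<le> c" if "c \<in> C" "x $ i < c" for c i
    using that assms(1) by (auto simp: u_def)
  have xlu: "x \<in> rect l u" using l u by (auto simp: in_rect_iff)
  have "{y \<in> unit_cube. same_side C x y} = rect l u"
  proof (intro Set.set_eqI iffI)
    fix y assume "y \<in> {y \<in> unit_cube. same_side C x y}"
    then show "y \<in> rect l u" using same_side_rect[of C x y l u] l u xlu by simp
  next
    fix y assume y: "y \<in> rect l u"
    have "same_side C x y"
      unfolding same_side_def
    proof (intro allI ballI)
      fix i c assume c: "c \<in> C"
      have "l $ i \<le> y $ i" "y $ i < u $ i" using y by (auto simp: in_rect_iff)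
      then show "c \<le> x $ i \<longleftrightarrow> c \<le> y $ i"
        using lmax[OF c, of i] umin[OF c, of i] by linarith
    qed
    then show "y \<in> {y \<in> unit_cube. same_side C x y}"
      using same_side_unit_cube assms by blast
  qed
  moreover have "\<forall>i. l $ i < u $ i" using l u by (meson le_less_trans)
  ultimately show ?thesis unfolding is_rectangle_def by blast
qed

text \<open>A class is determined by the sets of cuts lying below or at each coordinate.\<close>

lemma finite_same_side_classes:
  fixes M :: "(real^'n) set"
  assumes "finite C"
  shows "finite ((\<lambda>x. {y \<in> M. same_side C x y}) ` M)"
proof (rule finite_subset)
  let ?F = "\<Pi>\<^sub>E i\<in>(UNIV :: 'n set). Pow C"
  show "finite ((\<lambda>F. {y \<in> M. \<forall>i. {c\<in>C. c \<le> y $ i} = F i}) ` ?F)"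
    using assms by (intro finite_imageI finite_PiE) auto
  show "(\<lambda>x. {y \<in> M. same_side C x y}) ` M \<subseteq> (\<lambda>F. {y \<in> M. \<forall>i. {c\<in>C. c \<le> y $ i} = F i}) ` ?F"
  proof
    fix S assume "S \<in> (\<lambda>x. {y \<in> M. same_side C x y}) ` M"
    then obtain x where "S = {y \<in> M. same_side C x y}" by blast
    then have "S = {y \<in> M. \<forall>i. {c\<in>C. c \<le> y $ i} = {c\<in>C. c \<le> x $ i}}" by (auto simp: same_side_def)
    then show "S \<in> (\<lambda>F. {y \<in> M. \<forall>i. {c\<in>C. c \<le> y $ i} = F i}) ` ?F"
      by (rule image_eqI[where x = "\<lambda>i. {c\<in>C. c \<le> x $ i}"]) auto
  qed
qed

section \<open>Rectangle exchanges described by cuts\<close>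

lemma Rec_onD:
  assumes "f \<in> Rec_on M"
  shows "x \<notin> M \<Longrightarrow> f x = x" "bij_betw f M M"
  using assms by (auto simp: Rec_on_def)

lemma Rec_on_pieces:
  fixes M :: "(real^'n) set"
  assumes "f \<in> Rec_on M"
  obtains P and \<alpha> \<beta> \<nu> :: "(real^'n) set \<Rightarrow> real^'n"
  where "finite P" "\<Union>P = M" "\<And>R. R \<in> P \<Longrightarrow> R = rect (\<alpha> R) (\<beta> R)"
    "\<And>R i. R \<in> P \<Longrightarrow> \<alpha> R $ i < \<beta> R $ i" "\<And>R x. R \<in> P \<Longrightarrow> x \<in> R \<Longrightarrow> f x = x + \<nu> R" "disjoint P"
proof -
  obtain P where P: "finite P" "\<forall>R\<in>P. is_rectangle R" "disjoint P" "\<Union>P = M"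
    "\<forall>R\<in>P. \<exists>v. \<forall>x\<in>R. f x = x + v" using assms by (auto simp: Rec_on_def)
  have "\<forall>R\<in>P. \<exists>a b. (\<forall>i. a $ i < b $ i) \<and> R = rect a b" using P(2) by (simp add: is_rectangle_def)
  then obtain \<alpha> \<beta> where "\<forall>R\<in>P. (\<forall>i. \<alpha> R $ i < \<beta> R $ i) \<and> R = rect (\<alpha> R) (\<beta> R)" by metis
  moreover obtain \<nu> where "\<forall>R\<in>P. \<forall>x\<in>R. f x = x + \<nu> R" using P(5) by metis
  ultimately show ?thesis using that[of P \<alpha> \<beta> \<nu>] P by blast
qed

lemma Rec_on_finite_displacements:
  assumes "f \<in> Rec_on M"
  shows "finite ((\<lambda>x. f x - x) ` M)"
proof -
  obtain P \<alpha> \<beta> \<nu> where P: "finite P" "\<Union>P = M" "\<And>R. R \<in> P \<Longrightarrow> R = rect (\<alpha> R) (\<beta> R)"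
    "\<And>R i. R \<in> P \<Longrightarrow> \<alpha> R $ i < \<beta> R $ i" "\<And>R x. R \<in> P \<Longrightarrow> x \<in> R \<Longrightarrow> f x = x + \<nu> R" "disjoint P"
    by (rule Rec_on_pieces[OF assms]) blast
  have "(\<lambda>x. f x - x) ` M \<subseteq> \<nu> ` P"
  proof
    fix v assume "v \<in> (\<lambda>x. f x - x) ` M"
    then obtain x R where "v = f x - x" "R \<in> P" "x \<in> R" using P(2) by blast
    then show "v \<in> \<nu> ` P" using P(5) by auto
  qed
  then show ?thesis using P(1) finite_surj by blast
qed

text \<open>The cuts are the coordinates of the corners of the pieces. Together with the converse
  \<open>Rec_onI\<close>, this replaces partitions by finite cut sets, which are easily transported
  through compositions and inverses.\<close>

lemma Rec_on_cuts:
  fixes M :: "(real^'n) set"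
  assumes "f \<in> Rec_on M"
  obtains C where "finite C"
    "\<And>x y. x \<in> M \<Longrightarrow> same_side C x y \<Longrightarrow> f x - x = f y - y"
proof -
  obtain P \<alpha> \<beta> \<nu> where P: "finite P" "\<Union>P = M" "\<And>R. R \<in> P \<Longrightarrow> R = rect (\<alpha> R) (\<beta> R)"
    "\<And>R i. R \<in> P \<Longrightarrow> \<alpha> R $ i < \<beta> R $ i" "\<And>R x. R \<in> P \<Longrightarrow> x \<in> R \<Longrightarrow> f x = x + \<nu> R" "disjoint P"
    by (rule Rec_on_pieces[OF assms]) blast
  let ?C = "\<Union>R\<in>P. range (\<lambda>i. \<alpha> R $ i) \<union> range (\<lambda>i. \<beta> R $ i)"
  show thesis
  proof (rule that[of ?C])
    show "finite ?C" using P(1) by auto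
    fix x y assume x: "x \<in> M" and s: "same_side ?C x y"
    then obtain R where R: "R \<in> P" "x \<in> R" using P(2) by blast
    have "x \<in> rect (\<alpha> R) (\<beta> R) \<longleftrightarrow> y \<in> rect (\<alpha> R) (\<beta> R)"
      using R by (intro same_side_rect[OF s]) blast+
    then have "y \<in> R" using R P(3) by blast
    then show "f x - x = f y - y" using R P(5)[OF R(1)] by simp
  qed
qed

lemma Rec_onI:
  assumes "\<And>x. x \<notin> unit_cube \<Longrightarrow> f x = x" "bij_betw f unit_cube unit_cube" "finite C"
    "\<And>x y. x \<in> unit_cube \<Longrightarrow> y \<in> unit_cube \<Longrightarrow> same_side C x y \<Longrightarrow> f x - x = f y - y"
  shows "f \<in> Rec_on unit_cube"
proof -
  \<comment> \<open>With 0 and 1 among the cuts, the classes inside the cube are rectangles.\<close>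
  define C' where "C' = C \<union> {0, 1}"
  have sub: "same_side C x y" if "same_side C' x y" for x y :: "real^'a"
    using that by (auto simp: same_side_def C'_def)
  define P where "P = (\<lambda>x. {y \<in> unit_cube. same_side C' x y}) ` (unit_cube :: (real^'a) set)"
  have "finite P" unfolding P_def using assms(3) by (intro finite_same_side_classes) (simp add: C'_def)
  moreover have "\<forall>R\<in>P. is_rectangle R"
    using assms(3) by (auto simp: P_def C'_def intro!: same_side_class_is_rectangle)
  moreover have "disjoint P" unfolding P_def disjoint_def same_side_def by auto
  moreover have "\<Union>P = unit_cube" unfolding P_def same_side_def by auto
  moreover have "\<forall>R\<in>P. \<exists>v. \<forall>x\<in>R. f x = x + v"
  proof
    fix R assume "R \<in> P"
    then obtain z where z: "z \<in> unit_cube" "R = {y \<in> unit_cube. same_side C' z y}" unfolding P_def by blast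
    have "f x = x + (f z - z)" if "x \<in> R" for x
      using that z sub assms(4)[of z x] by (simp add: algebra_simps)
    then show "\<exists>v. \<forall>x\<in>R. f x = x + v" by blast
  qed
  ultimately show ?thesis using assms(1,2) unfolding Rec_on_def by blast
qed

lemma Rec_on_comp:
  assumes "f \<in> Rec_on unit_cube" "g \<in> Rec_on unit_cube"
  shows "g \<circ> f \<in> Rec_on (unit_cube :: (real^'n) set)"
proof -
  note f = Rec_onD[OF assms(1)] and g = Rec_onD[OF assms(2)]
  obtain C where C: "finite C" "\<And>x y. x \<in> unit_cube \<Longrightarrow> same_side C x y \<Longrightarrow> f x - x = f y - y"
    by (rule Rec_on_cuts[OF assms(1)]) blast
  obtain D where D: "finite D" "\<And>x y. x \<in> unit_cube \<Longrightarrow> same_side D x y \<Longrightarrow> g x - x = g y - y"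
    by (rule Rec_on_cuts[OF assms(2)]) blast
  let ?V = "(\<lambda>x. f x - x) ` unit_cube"
  \<comment> \<open>The point x + v passes the cut c of g in direction i when x passes c - v_i; f
    has only finitely many displacements v.\<close>
  let ?E = "C \<union> (\<lambda>(c, v, i). c - v $ i) ` (D \<times> ?V \<times> (UNIV :: 'n set))"
  show ?thesis
  proof (rule Rec_onI[of _ ?E])
    show "x \<notin> unit_cube \<Longrightarrow> (g \<circ> f) x = x" for x using f(1) g(1) by simp
    show "bij_betw (g \<circ> f) unit_cube unit_cube" using f(2) g(2) by (rule bij_betw_trans)
    show "finite ?E" using C(1) D(1) Rec_on_finite_displacements[OF assms(1)] by auto
    fix x y :: "real^'n" assume x: "x \<in> unit_cube" and s: "same_side ?E x y"
    then have fxy: "f x - x = f y - y" using C(2) by (auto simp: same_side_def)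
    have "same_side D (f x) (f y)"
      unfolding same_side_def
    proof (intro allI ballI)
      fix i c assume "c \<in> D"
      then have "(c - (f x - x) $ i) \<in> ?E" using x by force
      then have "c - (f x - x) $ i \<le> x $ i \<longleftrightarrow> c - (f x - x) $ i \<le> y $ i"
        using s unfolding same_side_def by blast
      moreover have "f y = y + (f x - x)" using fxy by (simp add: algebra_simps)
      then have "f y $ i = y $ i + (f x - x) $ i" by (metis vector_add_component)
      moreover have "f x $ i = x $ i + (f x - x) $ i" by simp
      ultimately show "c \<le> f x $ i \<longleftrightarrow> c \<le> f y $ i" by linarith
    qed
    moreover have "f x \<in> unit_cube" using x f(2) by (auto simp: bij_betw_def)
    ultimately have "g (f x) - f x = g (f y) - f y" using D(2) by blast
    then have "(g (f x) - f x) + (f x - x) = (g (f y) - f y) + (f y - y)" by (simp only: fxy)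
    then show "(g \<circ> f) x - x = (g \<circ> f) y - y" by simp
  qed
qed

lemma Rec_on_left_inverse:
  assumes "f \<in> Rec_on (unit_cube :: (real^'n) set)"
  shows "\<exists>g\<in>Rec_on unit_cube. g \<circ> f = id"
proof -
  note f = Rec_onD[OF assms]
  obtain C where C: "finite C" "\<And>x y. x \<in> unit_cube \<Longrightarrow> same_side C x y \<Longrightarrow> f x - x = f y - y"
    by (rule Rec_on_cuts[OF assms]) blast
  let ?V = "(\<lambda>x. f x - x) ` unit_cube"
  \<comment> \<open>The cuts of f are pushed forward by its displacements. Including 0 and 1 keeps y
    - v, the expected preimage of y, inside the cube.\<close>
  let ?E = "(\<lambda>(c, v, i). c + v $ i) ` ((C \<union> {0, 1}) \<times> ?V \<times> (UNIV :: 'n set))"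
  define g where "g x = (if x \<in> unit_cube then inv_into unit_cube f x else x)" for x
  have gf: "g (f x) = x" if "x \<in> unit_cube" for x
    using that f(2) by (auto simp: g_def bij_betw_def)
  have "g \<circ> f = id"
  proof
    show "(g \<circ> f) x = id x" for x using gf f(1) by (cases "x \<in> unit_cube") (auto simp: g_def)
  qed
  moreover have "g \<in> Rec_on unit_cube"
  proof (rule Rec_onI[of _ ?E])
    show "x \<notin> unit_cube \<Longrightarrow> g x = x" for x by (simp add: g_def)
    show "bij_betw g unit_cube unit_cube"
      using bij_betw_inv_into[OF f(2)] by (subst bij_betw_cong[of _ _ "inv_into unit_cube f"]) (auto simp: g_def)
    show "finite ?E" using C(1) Rec_on_finite_displacements[OF assms] by auto
    fix x y :: "real^'n" assume x: "x \<in> unit_cube" and s: "same_side ?E x y"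
    obtain x' where x': "x' \<in> unit_cube" "x = f x'" using x f(2) by (auto simp: bij_betw_def)
    define v where "v = f x' - x'"
    have s': "same_side (C \<union> {0, 1}) x' (y - v)"
      unfolding same_side_def
    proof (intro allI ballI)
      fix i c assume "c \<in> C \<union> {0, 1}"
      then have "c + v $ i \<in> ?E" using x'(1) unfolding v_def by force
      then have "c + v $ i \<le> x $ i \<longleftrightarrow> c + v $ i \<le> y $ i" using s unfolding same_side_def by blast
      then show "c \<le> x' $ i \<longleftrightarrow> c \<le> (y - v) $ i" by (simp add: v_def x'(2) algebra_simps)
    qed
    have y': "y - v \<in> unit_cube" using same_side_unit_cube[OF s' _ _ x'(1)] by simp
    have "f x' - x' = f (y - v) - (y - v)" using C(2)[OF x'(1)] s' by (simp add: same_side_def)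
    then have "f (y - v) = y" by (simp add: v_def algebra_simps)
    then have "g y = y - v" using gf[OF y'] by simp
    moreover have "g x = x - v" using gf[OF x'(1)] by (simp add: v_def x'(2))
    ultimately show "g x - x = g y - y" by simp
  qed
  ultimately show ?thesis by blast
qed

section \<open>The group of the cube and the subgroup of shuffles\<close>

lemma group_Rec_group: "group (Rec_group (unit_cube :: (real^'n) set))"
proof (rule groupI)
  have "id \<in> Rec_on (unit_cube :: (real^'n) set)" by (rule Rec_onI[of _ "{}"]) auto
  then show "\<one>\<^bsub>Rec_group unit_cube\<^esub> \<in> carrier (Rec_group (unit_cube :: (real^'n) set))"
    by (simp add: Rec_group_def)
qed (auto simp: Rec_group_def Rec_on_comp comp_assoc Rec_on_left_inverse)

lemma restricted_shuffles_subset_Rec_on: "restricted_shuffles unit_cube \<subseteq> Rec_on (unit_cube :: (real^'n) set)"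
proof
  fix f :: "real^'n \<Rightarrow> real^'n" assume "f \<in> restricted_shuffles unit_cube"
  then obtain a b i c where f: "f = restricted_shuffle a b i c" "\<forall>j. a $ j < b $ j"
    "rect a b \<subseteq> unit_cube" "a $ i < c" "c < b $ i" by (auto simp: restricted_shuffles_def)
  have upd: "upd_vec a i (a $ i) = a" "upd_vec b i (b $ i) = b" by (simp_all add: vec_eq_iff upd_vec_nth)
  define F where "F = (\<lambda>c. slab_map a b i (rotation (a $ i) c (b $ i)))"
  have fF: "f = F c" using f(4,5) by (simp add: f(1) F_def slab_map_rotation upd)
  have rng: "F c x \<in> rect a b" if "x \<in> rect a b" "a $ i < c" "c < b $ i" for c x
    using that by (auto simp: F_def slab_map_def rotation_def in_rect_split[of _ _ _ i] upd_vec_nth)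
  have out: "F c x = x" if "x \<notin> rect a b" for c x using that by (simp add: F_def slab_map_def)
  have cube: "F c ` unit_cube \<subseteq> unit_cube" if "a $ i < c" "c < b $ i" for c
  proof
    fix y assume "y \<in> F c ` unit_cube"
    then obtain x where "y = F c x" "x \<in> unit_cube" by blast
    then show "y \<in> unit_cube" using rng[OF _ that] out f(3) by (cases "x \<in> rect a b") auto
  qed
  \<comment> \<open>After the shuffle the block of length b_i - c comes first, so the inverse
    shuffle cuts at a_i + (b_i - c).\<close>
  have inv: "F (a $ i + b $ i - c) (F c x) = x" if "a $ i < c" "c < b $ i" for c x
  proof (cases "x \<in> rect a b")
    case True
    have "F (a $ i + b $ i - c) (F c x) $ j = x $ j" for j
      using rng[OF True that] True that by (auto simp: F_def slab_map_def upd_vec_nth rotation_def)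
    then show ?thesis by (simp add: vec_eq_iff)
  qed (simp add: out)
  define C where "C = insert c (range (($) a) \<union> range (($) b))"
  have "F c \<in> Rec_on unit_cube"
  proof (rule Rec_onI[of _ C])
    show "x \<notin> unit_cube \<Longrightarrow> F c x = x" for x using out f(3) by blast
    show "bij_betw (F c) unit_cube unit_cube"
      using f(4,5) inv[of "a $ i + b $ i - c"]
      by (intro bij_betw_byWitness[of _ "F (a $ i + b $ i - c)"] ballI inv cube) auto
    show "finite C" by (simp add: C_def)
    fix x y :: "real^'n" assume s: "same_side C x y"
    have "x \<in> rect a b \<longleftrightarrow> y \<in> rect a b" by (rule same_side_rect[OF s]) (auto simp: C_def)
    moreover have "c \<le> x $ i \<longleftrightarrow> c \<le> y $ i" using s by (auto simp: same_side_def C_def)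
    ultimately show "F c x - x = F c y - y"
      by (auto simp: F_def slab_map_def rotation_def upd_vec_nth vec_eq_iff in_rect_iff)
  qed
  then show "f \<in> Rec_on unit_cube" by (simp add: fF)
qed

lemma shuffle_group_subset_Rec_on: "shuffle_group \<subseteq> Rec_on (unit_cube :: (real^'n) set)"
  using group.generate_incl[OF group_Rec_group, of "restricted_shuffles unit_cube"] restricted_shuffles_subset_Rec_on
  by (simp add: shuffle_group_def Rec_group_def)

lemma Rec_on_in_shuffle_group:
  fixes f :: "real^'n \<Rightarrow> real^'n"
  assumes "f \<in> Rec_on unit_cube" "g \<in> shuffle_group" "g \<circ> f \<in> shuffle_group"
  shows "f \<in> shuffle_group"
proof -
  interpret group "Rec_group (unit_cube :: (real^'n) set)" by (rule group_Rec_group)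
  have g: "g \<in> carrier (Rec_group unit_cube)" and f: "f \<in> carrier (Rec_group unit_cube)"
    using assms shuffle_group_subset_Rec_on by (auto simp: Rec_group_def)
  have "inv\<^bsub>Rec_group unit_cube\<^esub> g \<otimes>\<^bsub>Rec_group unit_cube\<^esub> (g \<otimes>\<^bsub>Rec_group unit_cube\<^esub> f) = f"
    using f g by (simp add: m_assoc[symmetric])
  moreover have "inv\<^bsub>Rec_group unit_cube\<^esub> g \<in> shuffle_group"
    using generate_m_inv_closed[OF _ assms(2)[unfolded shuffle_group_def]] restricted_shuffles_subset_Rec_on
    by (simp add: shuffle_group_def Rec_group_def)
  then have "inv\<^bsub>Rec_group unit_cube\<^esub> g \<circ> (g \<circ> f) \<in> shuffle_group"
    using assms(3) by (rule comp_in_shuffle_group)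
  ultimately show ?thesis by (simp add: Rec_group_def)
qed

section \<open>Permutations of grid cells\<close>

locale interval_tiling =
  fixes T :: "(real \<times> real) set"
  assumes finite_tiling: "finite T"
    and tile_bounds: "(s, l) \<in> T \<Longrightarrow> 0 < l \<and> 0 \<le> s \<and> s + l \<le> 1"
    and tiling_cover: "0 \<le> x \<Longrightarrow> x < 1 \<Longrightarrow> \<exists>s l. (s, l) \<in> T \<and> s \<le> x \<and> x < s + l"
    and tiling_unique: "(s, l) \<in> T \<Longrightarrow> (s', l') \<in> T \<Longrightarrow> s \<le> x \<Longrightarrow> x < s + l \<Longrightarrow> s' \<le> x \<Longrightarrow> x < s' + l' \<Longrightarrow>
      s = s' \<and> l = l'"
begin

text \<open>A cell is given by its lower corner and its side lengths rather than by two corners,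
  since the shape \<open>l\<close> is what translations of cells preserve.\<close>

definition cell :: "real^'n \<Rightarrow> real^'n \<Rightarrow> bool" where
  "cell s l \<longleftrightarrow> (\<forall>i. (s $ i, l $ i) \<in> T)"

lemma cell_pos: "cell s l \<Longrightarrow> s $ i < (s + l) $ i"
  using tile_bounds by (auto simp: cell_def)

lemma cell_subset: "cell s l \<Longrightarrow> rect s (s + l) \<subseteq> unit_cube"
  using tile_bounds cell_pos by (subst rect_subset_unit_cube_iff) (auto simp: cell_def)

lemma cell_corner: "cell s l \<Longrightarrow> s \<in> rect s (s + l)"
  using cell_pos by (auto simp: in_rect_iff)

lemma cells_disjoint:
  assumes "cell s l" "cell s' l'" "x \<in> rect s (s + l)" "x \<in> rect s' (s' + l')"
  shows "s = s'" "l = l'"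
proof -
  have "s $ i = s' $ i \<and> l $ i = l' $ i" for i
    using assms tiling_unique[of "s $ i" "l $ i" "s' $ i" "l' $ i" "x $ i"] by (simp add: cell_def in_rect_iff)
  then show "s = s'" "l = l'" by (simp_all add: vec_eq_iff)
qed

lemma cells_cover:
  fixes x :: "real^'n"
  assumes "x \<in> unit_cube"
  shows "\<exists>s l. cell s l \<and> x \<in> rect s (s + l)"
proof -
  have "\<forall>i. \<exists>s l. (s, l) \<in> T \<and> s \<le> x $ i \<and> x $ i < s + l"
    using assms tiling_cover by (auto simp: unit_cube_def in_rect_iff)
  then obtain s l where "\<And>i. (s i, l i) \<in> T \<and> s i \<le> x $ i \<and> x $ i < s i + l i" by metis
  then show ?thesis
    by (intro exI[of _ "\<chi> i. s i"] exI[of _ "\<chi> i. l i"]) (auto simp: cell_def in_rect_iff)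
qed

lemma finite_cells: "finite {(s, l :: real^'n). cell s l}"
proof -
  have "inj (\<lambda>(s, l) i. (s $ i, l $ i :: real) :: real \<times> real)"
    by (auto simp: inj_def fun_eq_iff vec_eq_iff)
  then have "finite ((\<lambda>(s, l :: real^'n) i. (s $ i, l $ i)) -` (\<Pi>\<^sub>E i\<in>UNIV. T))"
    using finite_tiling by (intro finite_vimageI finite_PiE) auto
  moreover have "{(s, l :: real^'n). cell s l} = (\<lambda>(s, l) i. (s $ i, l $ i)) -` (\<Pi>\<^sub>E i\<in>UNIV. T)"
    by (auto simp: cell_def PiE_iff)
  ultimately show ?thesis by simp
qed

text \<open>Tiles of equal length are equal or disjoint. The result is the condition on the
  displacement in \<open>swap_map_in_shuffle_group\<close>.\<close>

lemma cell_translate_far: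
  assumes "cell s l" "cell t l"
  shows "t $ i = s $ i \<or> l $ i \<le> \<bar>t $ i - s $ i\<bar>"
proof (rule ccontr)
  assume *: "\<not> ?thesis"
  have T: "(s $ i, l $ i) \<in> T" "(t $ i, l $ i) \<in> T" using assms by (simp_all add: cell_def)
  have "0 < l $ i" using tile_bounds T(1) by blast
  then have "max (s $ i) (t $ i) < s $ i + l $ i" "max (s $ i) (t $ i) < t $ i + l $ i"
    using * by linarith+
  then have "s $ i = t $ i" using tiling_unique[OF T, of "max (s $ i) (t $ i)"] by simp
  then show False using * by simp
qed

lemma swap_cells_in_shuffle_group:
  assumes "cell s l" "cell t l"
  shows "swap_map s (s + l) (t - s) \<in> shuffle_group"
proof (rule swap_map_in_shuffle_group)
  show "rect (s + (t - s)) (s + l + (t - s)) \<subseteq> unit_cube"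
    using cell_subset[OF assms(2)] by (simp add: algebra_simps)
  show "\<forall>i. (t - s) $ i = 0 \<or> (s + l) $ i - s $ i \<le> \<bar>(t - s) $ i\<bar>"
    using cell_translate_far[OF assms] by simp
qed (use assms(1) cell_pos cell_subset in blast)+

definition permutes_cells :: "(real^'n \<Rightarrow> real^'n) \<Rightarrow> bool" where
  "permutes_cells h \<longleftrightarrow> (\<forall>s l. cell s l \<longrightarrow> (\<exists>t. cell t l \<and> (\<forall>x\<in>rect s (s + l). h x = x + (t - s))))"

text \<open>A permutation is a product of transpositions, by induction on the number of moved cells.
  Swapping a moved cell s with its image t makes s fixed and disturbs no fixed cell: by injectivity
  t is moved as well. Since h is a translation on each cell, its value at the corner decides whether
  the cell is moved.\<close>

lemma permutes_cells_in_shuffle_group: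
  fixes h :: "real^'n \<Rightarrow> real^'n"
  assumes "inj h" "\<And>x. x \<notin> unit_cube \<Longrightarrow> h x = x" "permutes_cells h"
  shows "h \<in> shuffle_group"
  using assms
proof (induction "card {(s, l). cell s l \<and> h s \<noteq> s}" arbitrary: h rule: less_induct)
  case less
  have fixed: "h x = x" if "cell s l" "h s = s" "x \<in> rect s (s + l)" for s l x
    using less.prems(3) that cell_corner unfolding permutes_cells_def by force
  show ?case
  proof (cases "\<exists>s l. cell s l \<and> h s \<noteq> s")
    case False
    have "h x = x" for x
      using False fixed cells_cover[of x] less.prems(2)[of x] by blast
    then have "h = id" by auto
    then show ?thesis by (simp add: id_in_shuffle_group)
  next
    case True
    then obtain s l where s: "cell s l" "h s \<noteq> s" by blast
    then obtain t where t: "cell t l" "\<And>x. x \<in> rect s (s + l) \<Longrightarrow> h x = x + (t - s)"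
      using less.prems(3) unfolding permutes_cells_def by blast
    have hs: "h s = t" using t(2) cell_corner[OF s(1)] by simp
    then have "t \<noteq> s" using s by auto
    then obtain i where "t $ i \<noteq> s $ i" by (auto simp: vec_eq_iff)
    then have far: "(s + l) $ i - s $ i \<le> \<bar>(t - s) $ i\<bar>" using cell_translate_far[OF s(1) t(1), of i] by simp
    define \<tau> where "\<tau> = swap_map s (s + l) (t - s)"
    have \<tau>\<tau>: "\<tau> (\<tau> x) = x" for x unfolding \<tau>_def by (rule swap_map_involution[OF far])
    have \<tau>s: "\<tau> x = x + (t - s)" if "x \<in> rect s (s + l)" for x using that by (simp add: \<tau>_def swap_map_def)
    have mem: "x - (t - s) \<in> rect s (s + l) \<longleftrightarrow> x \<in> rect t (t + l)" for x
      using in_rect_shift[of x s "t - s" "s + l"] by (simp add: algebra_simps)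
    have \<tau>t: "\<tau> x = x - (t - s)" if "x \<in> rect t (t + l)" for x
      using that rect_shift_disjoint[OF far, of x] mem by (auto simp: \<tau>_def swap_map_def)
    have \<tau>o: "\<tau> x = x" if "x \<notin> rect s (s + l)" "x \<notin> rect t (t + l)" for x
      using that by (simp add: \<tau>_def swap_map_def mem)
    have \<tau>: "\<tau> \<in> shuffle_group" unfolding \<tau>_def using s(1) t(1) by (rule swap_cells_in_shuffle_group)
    have "inj \<tau>" using \<tau>\<tau> by (metis injI)
    have inj: "inj (\<tau> \<circ> h)" using \<open>inj \<tau>\<close> less.prems(1) by (rule inj_compose)
    have out: "(\<tau> \<circ> h) x = x" if "x \<notin> unit_cube" for x
      using that less.prems(2) \<tau>o cell_subset[OF s(1)] cell_subset[OF t(1)] by auto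
    have perm\<tau>: "\<exists>t''. cell t'' l' \<and> (\<forall>x\<in>rect t' (t' + l'). \<tau> x = x + (t'' - t'))" if c': "cell t' l'" for t' l'
    proof -
      consider "t' = s" "l' = l" | "t' = t" "l' = l"
        | "rect t' (t' + l') \<inter> rect s (s + l) = {}" "rect t' (t' + l') \<inter> rect t (t + l) = {}"
        using cells_disjoint[OF c' s(1)] cells_disjoint[OF c' t(1)] by blast
      then show ?thesis
      proof cases
        case 1
        then show ?thesis using t(1) \<tau>s by blast
      next
        case 2
        then show ?thesis using s(1) \<tau>t by (intro exI[of _ s]) auto
      next
        case 3
        then show ?thesis using c' \<tau>o by (intro exI[of _ t']) auto
      qed
    qed
    have perm: "permutes_cells (\<tau> \<circ> h)"
      unfolding permutes_cells_def
    proof (intro allI impI)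
      fix s' l' :: "real^'n" assume s': "cell s' l'"
      then obtain t' where t': "cell t' l'" "\<And>x. x \<in> rect s' (s' + l') \<Longrightarrow> h x = x + (t' - s')"
        using less.prems(3) unfolding permutes_cells_def by blast
      obtain t'' where t'': "cell t'' l'" "\<And>x. x \<in> rect t' (t' + l') \<Longrightarrow> \<tau> x = x + (t'' - t')"
        using perm\<tau>[OF t'(1)] by blast
      have "(\<tau> \<circ> h) x = x + (t'' - s')" if "x \<in> rect s' (s' + l')" for x
      proof -
        have "x + (t' - s') \<in> rect t' (t' + l')"
          using that in_rect_shift[of "x + (t' - s')" s' "t' - s'" "s' + l'"] by (simp add: algebra_simps)
        then have "\<tau> (x + (t' - s')) = x + (t' - s') + (t'' - t')" by (rule t''(2))
        then show ?thesis using t'(2)[OF that] by simp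
      qed
      then show "\<exists>t. cell t l' \<and> (\<forall>x\<in>rect s' (s' + l'). (\<tau> \<circ> h) x = x + (t - s'))" using t''(1) by blast
    qed
    have "card {(s, l). cell s l \<and> (\<tau> \<circ> h) s \<noteq> s} < card {(s, l). cell s l \<and> h s \<noteq> s}"
    proof (rule psubset_card_mono)
      show "finite {(s, l). cell s l \<and> h s \<noteq> s}" by (rule finite_subset[OF _ finite_cells]) auto
      have "(\<tau> \<circ> h) s' = s'" if s': "cell s' l'" "h s' = s'" for s' l'
      proof -
        have "s' \<notin> rect s (s + l)" using cells_disjoint[OF s'(1) s(1) cell_corner[OF s'(1)]] s' s by blast
        moreover have "s' \<notin> rect t (t + l)"
        proof
          assume "s' \<in> rect t (t + l)"
          then have "s' = t" using cells_disjoint[OF s'(1) t(1) cell_corner[OF s'(1)]] by blast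
          then have "h t = h s" using s' hs by simp
          then show False using less.prems(1) \<open>t \<noteq> s\<close> by (auto dest: injD)
        qed
        ultimately show ?thesis using \<tau>o s' by simp
      qed
      moreover have "(\<tau> \<circ> h) s = s" using hs \<tau>t cell_corner[OF t(1)] by simp
      ultimately show "{(s, l). cell s l \<and> (\<tau> \<circ> h) s \<noteq> s} \<subset> {(s, l). cell s l \<and> h s \<noteq> s}"
        using s by blast
    qed
    then have "\<tau> \<circ> h \<in> shuffle_group" using inj out perm by (rule less.hyps)
    then have "\<tau> \<circ> (\<tau> \<circ> h) \<in> shuffle_group" by (rule comp_in_shuffle_group[OF \<tau>])
    moreover have "\<tau> \<circ> (\<tau> \<circ> h) = h" using \<tau>\<tau> by auto
    ultimately show ?thesis by simp
  qed
qed

text \<open>\<open>w i\<close> subdivides a side of the box into grid tiles. Shifted by v these need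
  not be grid tiles, while those of \<open>w' i\<close> are. The product g of the exchanges that
  turn one into the other makes x \<mapsto> g (x + v) carry cells to cells.\<close>

lemma rearrange_translated_rect:
  fixes a b v :: "real^'n" and w w' :: "'n \<Rightarrow> real list"
  assumes ab: "\<forall>i. a $ i < b $ i" and sub: "rect (a + v) (b + v) \<subseteq> unit_cube"
    and w: "\<And>i. mset (w i) = mset (w' i)" "\<And>i. \<forall>l\<in>set (w i). 0 < l" "\<And>i. a $ i + sum_list (w i) = b $ i"
      "\<And>i. tiles (a $ i) (w i) \<subseteq> T" "\<And>i. tiles (a $ i + v $ i) (w' i) \<subseteq> T"
  obtains g where "g \<in> shuffle_group"
    "\<And>x. x \<notin> rect (a + v) (b + v) \<Longrightarrow> g x = x"
    "\<And>x. x \<in> rect (a + v) (b + v) \<Longrightarrow> g x \<in> rect (a + v) (b + v)"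
    "\<And>s l. cell s l \<Longrightarrow> rect s (s + l) \<inter> rect a b \<noteq> {} \<Longrightarrow>
      rect s (s + l) \<subseteq> rect a b \<and> (\<exists>t. cell t l \<and> (\<forall>x\<in>rect s (s + l). g (x + v) = x + (t - s)))"
proof -
  have "\<forall>i. \<exists>\<phi>. \<phi> \<in> interval_exchanges ((a + v) $ i) ((b + v) $ i) \<and>
      (\<forall>(s, l)\<in>tiles (a $ i + v $ i) (w i). \<exists>t. (t, l) \<in> tiles (a $ i + v $ i) (w' i) \<and>
        (\<forall>x. s \<le> x \<and> x < s + l \<longrightarrow> \<phi> x = x + (t - s)))"
  proof
    fix i
    have "(a + v) $ i = a $ i + v $ i" "(b + v) $ i = a $ i + v $ i + sum_list (w i)" using w(3)[of i] by auto
    then show "\<exists>\<phi>. \<phi> \<in> interval_exchanges ((a + v) $ i) ((b + v) $ i) \<and>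
      (\<forall>(s, l)\<in>tiles (a $ i + v $ i) (w i). \<exists>t. (t, l) \<in> tiles (a $ i + v $ i) (w' i) \<and>
        (\<forall>x. s \<le> x \<and> x < s + l \<longrightarrow> \<phi> x = x + (t - s)))"
      using interval_exchanges_rearrange[OF w(1,2), of "a $ i + v $ i" i] unfolding Bex_def by (simp only:)
  qed
  from choice[OF this] obtain \<phi> where \<phi>':
    "\<forall>i. \<phi> i \<in> interval_exchanges ((a + v) $ i) ((b + v) $ i) \<and>
      (\<forall>(s, l)\<in>tiles (a $ i + v $ i) (w i). \<exists>t. (t, l) \<in> tiles (a $ i + v $ i) (w' i) \<and>
        (\<forall>x. s \<le> x \<and> x < s + l \<longrightarrow> \<phi> i x = x + (t - s)))" ..
  then have \<phi>: "\<phi> i \<in> interval_exchanges ((a + v) $ i) ((b + v) $ i)"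
    "\<forall>(s, l)\<in>tiles (a $ i + v $ i) (w i). \<exists>t. (t, l) \<in> tiles (a $ i + v $ i) (w' i) \<and>
      (\<forall>x. s \<le> x \<and> x < s + l \<longrightarrow> \<phi> i x = x + (t - s))" for i
    by blast+
  define g where "g = (\<lambda>x. if x \<in> rect (a + v) (b + v) then \<chi> i. \<phi> i (x $ i) else x)"
  show thesis
  proof (rule that[of g])
    show "g \<in> shuffle_group"
      unfolding g_def using \<phi>(1) ab sub by (intro product_map_in_shuffle_group) auto
    show "x \<notin> rect (a + v) (b + v) \<Longrightarrow> g x = x" for x by (simp add: g_def)
    show "g x \<in> rect (a + v) (b + v)" if "x \<in> rect (a + v) (b + v)" for x
      using that interval_exchanges_range[OF \<phi>(1)] by (simp add: g_def in_rect_iff)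
    fix s l :: "real^'n" assume c: "cell s l" and "rect s (s + l) \<inter> rect a b \<noteq> {}"
    then obtain y where y: "y \<in> rect s (s + l)" "y \<in> rect a b" by blast
    \<comment> \<open>The side of the cell and the tile of \<open>w i\<close> at y_i are grid tiles
      with a common point, hence equal. So a cell that meets the box lies in it.\<close>
    have sl: "(s $ i, l $ i) \<in> tiles (a $ i) (w i)" for i
    proof -
      obtain s' l' where s': "(s', l') \<in> tiles (a $ i) (w i)" "s' \<le> y $ i" "y $ i < s' + l'"
        using tiles_cover[of "a $ i" "y $ i" "w i"] y(2) w(3)[of i] by (auto simp: in_rect_iff)
      then have "s $ i = s' \<and> l $ i = l'"
        using c y(1) w(4)[of i] by (intro tiling_unique[of _ _ _ _ "y $ i"]) (auto simp: cell_def in_rect_iff)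
      then show ?thesis using s'(1) by simp
    qed
    have bnd: "a $ i \<le> s $ i" "s $ i + l $ i \<le> b $ i" for i
      using tiles_bounds(2,3)[OF w(2) sl, of i] w(3)[of i] by auto
    have sub': "rect s (s + l) \<subseteq> rect a b"
    proof
      fix x assume x: "x \<in> rect s (s + l)"
      have "a $ i \<le> x $ i \<and> x $ i < b $ i" for i
      proof -
        have "s $ i \<le> x $ i" "x $ i < s $ i + l $ i" using x by (simp_all add: in_rect_iff)
        then show ?thesis using bnd[of i] by linarith
      qed
      then show "x \<in> rect a b" by (simp add: in_rect_iff)
    qed
    have "\<forall>i. \<exists>t. (t, l $ i) \<in> tiles (a $ i + v $ i) (w' i) \<and>
        (\<forall>x. s $ i + v $ i \<le> x \<and> x < s $ i + v $ i + l $ i \<longrightarrow> \<phi> i x = x + (t - (s $ i + v $ i)))"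
      using \<phi>(2) tiles_shift[OF sl] by blast
    then obtain t where t: "\<And>i. (t i, l $ i) \<in> tiles (a $ i + v $ i) (w' i)"
        "\<And>i x. s $ i + v $ i \<le> x \<Longrightarrow> x < s $ i + v $ i + l $ i \<Longrightarrow> \<phi> i x = x + (t i - (s $ i + v $ i))" by metis
    have "cell (\<chi> i. t i) l" using t(1) w(5) by (auto simp: cell_def)
    moreover have "g (x + v) = x + ((\<chi> i. t i) - s)" if x: "x \<in> rect s (s + l)" for x
    proof -
      have "x + v \<in> rect (a + v) (b + v)" using x sub' by (auto simp: in_rect_shift)
      moreover have "\<phi> i (x $ i + v $ i) = x $ i + (t i - s $ i)" for i
        using x t(2)[of i "x $ i + v $ i"] by (simp add: in_rect_iff add.assoc)
      ultimately show ?thesis by (simp add: g_def vec_eq_iff)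
    qed
    ultimately show "rect s (s + l) \<subseteq> rect a b \<and>
        (\<exists>t. cell t l \<and> (\<forall>x\<in>rect s (s + l). g (x + v) = x + (t - s)))" using sub' by blast
  qed
qed

end

lemma interval_tiling_tiles:
  assumes "\<forall>l\<in>set w. 0 < l" "sum_list w = 1"
  shows "interval_tiling (tiles 0 w)"
proof
  show "finite (tiles 0 w)" by (rule finite_tiles)
  show "(s, l) \<in> tiles 0 w \<Longrightarrow> 0 < l \<and> 0 \<le> s \<and> s + l \<le> 1" for s l
    using tiles_bounds[OF assms(1), of s l 0] assms(2) by simp
  show "0 \<le> x \<Longrightarrow> x < 1 \<Longrightarrow> \<exists>s l. (s, l) \<in> tiles 0 w \<and> s \<le> x \<and> x < s + l" for x
    using tiles_cover[of 0 x w] assms(2) by simp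
qed (rule tiles_unique[OF assms(1)])

section \<open>Generation by restricted shuffles\<close>

lemma Rec_on_subset_shuffle_group:
  fixes f :: "real^'n \<Rightarrow> real^'n"
  assumes f: "f \<in> Rec_on unit_cube"
  shows "f \<in> shuffle_group"
proof -
  obtain P and \<alpha> \<beta> \<nu> :: "(real^'n) set \<Rightarrow> real^'n"
    where P: "finite P" "\<Union>P = unit_cube" "\<And>R. R \<in> P \<Longrightarrow> R = rect (\<alpha> R) (\<beta> R)"
    "\<And>R i. R \<in> P \<Longrightarrow> \<alpha> R $ i < \<beta> R $ i" "\<And>R x. R \<in> P \<Longrightarrow> x \<in> R \<Longrightarrow> f x = x + \<nu> R" "disjoint P"
    by (rule Rec_on_pieces[OF f]) blast
  note outside = Rec_onD(1)[OF f] and bij = Rec_onD(2)[OF f]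
  \<comment> \<open>This is f(R), written as a rectangle; injectivity of f makes these sets
    disjoint.\<close>
  define Q where "Q R = rect (\<alpha> R + \<nu> R) (\<beta> R + \<nu> R)" for R
  have Q: "x \<in> Q R \<longleftrightarrow> x - \<nu> R \<in> R" if "R \<in> P" for x R
    by (simp only: Q_def in_rect_shift P(3)[OF that, symmetric])
  have fQ: "f x \<in> Q R" if "R \<in> P" "x \<in> R" for x R
    using that P(5) by (simp add: Q)
  have Qf: "\<exists>x\<in>R. y = f x" if "R \<in> P" "y \<in> Q R" for y R
    using that P(5)[OF that(1), of "y - \<nu> R"] by (intro bexI[of _ "y - \<nu> R"]) (auto simp: Q)
  have R_sub: "R \<subseteq> unit_cube" if "R \<in> P" for R using that P(2) by blast
  have Q_sub: "Q R \<subseteq> unit_cube" if "R \<in> P" for R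
    using Qf[OF that] R_sub[OF that] bij_betwE[OF bij] by blast
  have Q_disj: "R = R'" if R: "R \<in> P" "R' \<in> P" "y \<in> Q R" "y \<in> Q R'" for R R' y
  proof -
    obtain x x' where x: "x \<in> R" "x' \<in> R'" "f x = f x'" using Qf R by metis
    then have "x = x'"
      using inj_onD[OF bij_betw_imp_inj_on[OF bij] x(3)] R_sub R x(1,2) by blast
    then show ?thesis using P(6) R x unfolding disjoint_def by blast
  qed

  \<comment> \<open>The coordinates of all axes go into one cut set, so that a single basis and a
    single subdivision serve every axis.\<close>
  define ends where "ends R i = {\<alpha> R $ i, \<beta> R $ i, \<alpha> R $ i + \<nu> R $ i, \<beta> R $ i + \<nu> R $ i}" for R i
  define C where "C = {0, 1} \<union> (\<Union>R\<in>P. \<Union>i. ends R i)"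
  have "ends R i \<subseteq> C" if "R \<in> P" for R i using that unfolding C_def by blast
  then have C: "\<alpha> R $ i \<in> C" "\<beta> R $ i \<in> C" "\<alpha> R $ i + \<nu> R $ i \<in> C" "\<beta> R $ i + \<nu> R $ i \<in> C"
    if "R \<in> P" for R i
    using that unfolding ends_def by (meson insert_subset)+
  have C01: "0 \<le> c \<and> c \<le> 1" if "c \<in> C" for c
  proof -
    have bnd: "0 \<le> \<alpha> R $ i" "\<alpha> R $ i \<le> 1" "0 \<le> \<beta> R $ i" "\<beta> R $ i \<le> 1"
      "0 \<le> \<alpha> R $ i + \<nu> R $ i" "\<alpha> R $ i + \<nu> R $ i \<le> 1" "0 \<le> \<beta> R $ i + \<nu> R $ i" "\<beta> R $ i + \<nu> R $ i \<le> 1"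
      if R: "R \<in> P" for R i
    proof -
      have "0 \<le> \<alpha> R $ i \<and> \<beta> R $ i \<le> 1 \<and> 0 \<le> \<alpha> R $ i + \<nu> R $ i \<and> \<beta> R $ i + \<nu> R $ i \<le> 1"
        using R_sub[OF R] Q_sub[OF R] P(4)[OF R] rect_subset_unit_cube_iff[of "\<alpha> R" "\<beta> R"]
          rect_subset_unit_cube_iff[of "\<alpha> R + \<nu> R" "\<beta> R + \<nu> R"]
        by (simp add: Q_def P(3)[OF R, symmetric])
      then show "0 \<le> \<alpha> R $ i" "\<alpha> R $ i \<le> 1" "0 \<le> \<beta> R $ i" "\<beta> R $ i \<le> 1"
        "0 \<le> \<alpha> R $ i + \<nu> R $ i" "\<alpha> R $ i + \<nu> R $ i \<le> 1" "0 \<le> \<beta> R $ i + \<nu> R $ i" "\<beta> R $ i + \<nu> R $ i \<le> 1"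
        using P(4)[OF R, of i] by linarith+
    qed
    from that consider "c = 0" | "c = 1" | R i where "R \<in> P" "c \<in> ends R i"
      unfolding C_def by blast
    then show ?thesis using bnd by cases (auto simp: ends_def)
  qed
  have "finite C" using P(1) by (simp add: C_def ends_def)
  define S where "S = {d - c | c d. c \<in> C \<and> d \<in> C \<and> c < d}"
  have "S \<subseteq> (\<lambda>(c, d). d - c) ` (C \<times> C)" by (auto simp: S_def)
  then have "finite S" by (rule finite_subset) (simp add: \<open>finite C\<close>)
  moreover have "0 < s" if "s \<in> S" for s using that by (auto simp: S_def)
  ultimately obtain L where L: "finite L" "\<forall>l\<in>L. 0 < l" "int_independent L" "S \<subseteq> word_sums L"
    using ex_int_independent[of S] by blast
  have diff: "d - c \<in> word_sums L" if "c \<in> C" "d \<in> C" "c < d" for c d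
    using that L(4) unfolding S_def by blast
  have "0 \<in> C" "1 \<in> C" by (simp_all add: C_def)
  obtain W where W: "set W \<subseteq> L" "0 + sum_list W \<in> C"
    "\<And>c d. c \<in> C \<Longrightarrow> d \<in> C \<Longrightarrow> c < d \<Longrightarrow> \<exists>m. set m \<subseteq> L \<and> c + sum_list m = d \<and> tiles c m \<subseteq> tiles 0 W"
    using ex_subdivision[OF \<open>finite C\<close> \<open>0 \<in> C\<close> _ L(2) diff] C01 by blast
  have Wpos: "\<forall>l\<in>set W. 0 < l" using W(1) L(2) by blast
  have "sum_list W = 1"
  proof (rule antisym)
    show "sum_list W \<le> 1" using C01 W(2) by simp
    \<comment> \<open>If W summed to less than 1, that sum would be a point in a tile of m, which is
      also a tile of W and so ends no later than the sum.\<close>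
    obtain m where m: "set m \<subseteq> L" "sum_list m = 1" "tiles 0 m \<subseteq> tiles 0 W"
      using W(3)[OF \<open>0 \<in> C\<close> \<open>1 \<in> C\<close>] by auto
    show "1 \<le> sum_list W"
    proof (rule ccontr)
      assume *: "\<not> 1 \<le> sum_list W"
      have "0 \<le> sum_list W" using Wpos by (intro sum_list_nonneg) (simp add: less_imp_le)
      then obtain s l where "(s, l) \<in> tiles 0 m" "sum_list W < s + l"
        using tiles_cover[of 0 "sum_list W" m] * m(2) by auto
      then show False using tiles_bounds(3)[OF Wpos, of s l 0] m(3) by auto
    qed
  qed
  then interpret interval_tiling "tiles 0 W" using Wpos by (intro interval_tiling_tiles)

  have piece: "\<exists>g. g \<in> shuffle_group \<and> (\<forall>x. x \<notin> Q R \<longrightarrow> g x = x) \<and> (\<forall>x\<in>Q R. g x \<in> Q R) \<and>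
      (\<forall>s l. cell s l \<longrightarrow> rect s (s + l) \<inter> R \<noteq> {} \<longrightarrow> rect s (s + l) \<subseteq> R \<and>
        (\<exists>t. cell t l \<and> (\<forall>x\<in>rect s (s + l). g (x + \<nu> R) = x + (t - s))))" if R: "R \<in> P" for R
  proof -
    have "\<exists>m. set m \<subseteq> L \<and> \<alpha> R $ i + sum_list m = \<beta> R $ i \<and> tiles (\<alpha> R $ i) m \<subseteq> tiles 0 W" for i
      using W(3) C R P(4)[OF R] by blast
    then obtain w where w: "\<And>i. set (w i) \<subseteq> L" "\<And>i. \<alpha> R $ i + sum_list (w i) = \<beta> R $ i"
      "\<And>i. tiles (\<alpha> R $ i) (w i) \<subseteq> tiles 0 W" by metis
    have "\<exists>m. set m \<subseteq> L \<and> (\<alpha> R $ i + \<nu> R $ i) + sum_list m = \<beta> R $ i + \<nu> R $ i \<and>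
        tiles (\<alpha> R $ i + \<nu> R $ i) m \<subseteq> tiles 0 W" for i
      using C(3,4)[OF R] P(4)[OF R] by (intro W(3)) auto
    then obtain w' where w': "\<And>i. set (w' i) \<subseteq> L"
      "\<And>i. (\<alpha> R $ i + \<nu> R $ i) + sum_list (w' i) = \<beta> R $ i + \<nu> R $ i"
      "\<And>i. tiles (\<alpha> R $ i + \<nu> R $ i) (w' i) \<subseteq> tiles 0 W" by metis
    \<comment> \<open>Both words sum to \<beta> R $ i - \<alpha> R $ i; here the independence of L
      enters.\<close>
    have eq: "mset (w i) = mset (w' i)" for i
    proof (rule int_independent_mset_eq[OF L(3,1) w(1) w'(1)])
      show "sum_list (w i) = sum_list (w' i)" using w(2)[of i] w'(2)[of i] by linarith
    qed
    have pos: "\<forall>l\<in>set (w i). 0 < l" for i using w(1) L(2) by blast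
    obtain g where "g \<in> shuffle_group"
      "\<And>x. x \<notin> rect (\<alpha> R + \<nu> R) (\<beta> R + \<nu> R) \<Longrightarrow> g x = x"
      "\<And>x. x \<in> rect (\<alpha> R + \<nu> R) (\<beta> R + \<nu> R) \<Longrightarrow> g x \<in> rect (\<alpha> R + \<nu> R) (\<beta> R + \<nu> R)"
      "\<And>s l. cell s l \<Longrightarrow> rect s (s + l) \<inter> rect (\<alpha> R) (\<beta> R) \<noteq> {} \<Longrightarrow>
        rect s (s + l) \<subseteq> rect (\<alpha> R) (\<beta> R) \<and> (\<exists>t. cell t l \<and> (\<forall>x\<in>rect s (s + l). g (x + \<nu> R) = x + (t - s)))"
      using rearrange_translated_rect[of "\<alpha> R" "\<beta> R" "\<nu> R" w w'] P(4)[OF R] Q_sub[OF R] eq pos w(2,3) w'(3)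
      unfolding Q_def by blast
    then show ?thesis unfolding Q_def P(3)[OF R, symmetric] by blast
  qed
  have cell_sub: "rect s (s + l) \<subseteq> R" if "R \<in> P" "cell s l" "rect s (s + l) \<inter> R \<noteq> {}" for R s l
    using piece[OF that(1)] that(2,3) by metis
  \<comment> \<open>The corrections of the single pieces are composed. Each preserves its own
    \<open>Q R\<close> and fixes everything outside it, so on any \<open>Q R\<close> only one of
    them acts.\<close>
  have "\<exists>g\<in>shuffle_group. (\<forall>x. x \<notin> (\<Union>R\<in>P'. Q R) \<longrightarrow> g x = x) \<and>
      (\<forall>R\<in>P'. \<forall>s l. cell s l \<longrightarrow> rect s (s + l) \<inter> R \<noteq> {} \<longrightarrow>
        (\<exists>t. cell t l \<and> (\<forall>x\<in>rect s (s + l). g (f x) = x + (t - s))))" if "P' \<subseteq> P" for P'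
    using finite_subset[OF that P(1)] that
  proof (induction P' rule: finite_induct)
    case empty
    show ?case using id_in_shuffle_group by (intro bexI[of _ id]) auto
  next
    case (insert R P')
    have "P' \<subseteq> P" using insert.prems by blast
    from insert.IH[OF this] obtain g where g: "g \<in> shuffle_group" "\<forall>x. x \<notin> (\<Union>R\<in>P'. Q R) \<longrightarrow> g x = x"
      "\<forall>R\<in>P'. \<forall>s l. cell s l \<longrightarrow> rect s (s + l) \<inter> R \<noteq> {} \<longrightarrow>
        (\<exists>t. cell t l \<and> (\<forall>x\<in>rect s (s + l). g (f x) = x + (t - s)))" by (elim bexE conjE) (rule that)
    have R: "R \<in> P" using insert.prems by blast
    obtain k where k: "k \<in> shuffle_group" "\<And>x. x \<notin> Q R \<Longrightarrow> k x = x" "\<And>x. x \<in> Q R \<Longrightarrow> k x \<in> Q R"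
      "\<And>s l. cell s l \<Longrightarrow> rect s (s + l) \<inter> R \<noteq> {} \<Longrightarrow> rect s (s + l) \<subseteq> R \<and>
        (\<exists>t. cell t l \<and> (\<forall>x\<in>rect s (s + l). k (x + \<nu> R) = x + (t - s)))"
      using piece[OF R] by blast
    show ?case
    proof (intro bexI[of _ "g \<circ> k"] conjI allI impI ballI)
      show "g \<circ> k \<in> shuffle_group" using g(1) k(1) by (rule comp_in_shuffle_group)
      show "(g \<circ> k) x = x" if "x \<notin> (\<Union>R\<in>insert R P'. Q R)" for x using that g(2) k(2) by simp
      fix R' s l assume R': "R' \<in> insert R P'" and c: "cell s l" and ne: "rect s (s + l) \<inter> R' \<noteq> {}"
      have R'P: "R' \<in> P" using R' insert.prems by blast
      have sub: "rect s (s + l) \<subseteq> R'" using cell_sub[OF R'P c ne] .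
      show "\<exists>t. cell t l \<and> (\<forall>x\<in>rect s (s + l). (g \<circ> k) (f x) = x + (t - s))"
      proof (cases "R' = R")
        case True
        obtain t where t: "cell t l" "\<And>x. x \<in> rect s (s + l) \<Longrightarrow> k (x + \<nu> R) = x + (t - s)"
          using k(4)[OF c] ne True by blast
        have "(g \<circ> k) (f x) = x + (t - s)" if x: "x \<in> rect s (s + l)" for x
        proof -
          have xR: "x \<in> R" using x sub True by blast
          have "k (f x) \<in> Q R" using fQ[OF R xR] by (rule k(3))
          then have "k (f x) \<notin> (\<Union>R\<in>P'. Q R)" using Q_disj[OF R] insert.hyps insert.prems by blast
          then show ?thesis using g(2) t(2)[OF x] P(5)[OF R xR] by simp
        qed
        then show ?thesis using t(1) by blast
      next
        case False
        then have "R' \<in> P'" using R' by blast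
        with g(3) c ne have "\<exists>t. cell t l \<and> (\<forall>x\<in>rect s (s + l). g (f x) = x + (t - s))" by simp
        then obtain t where t: "cell t l" "\<And>x. x \<in> rect s (s + l) \<Longrightarrow> g (f x) = x + (t - s)" by blast
        have "k (f x) = f x" if "x \<in> rect s (s + l)" for x
        proof (rule k(2))
          have "f x \<in> Q R'" using fQ[OF R'P] that sub by blast
          then show "f x \<notin> Q R" using Q_disj[OF R R'P] False by blast
        qed
        then show ?thesis using t by (intro exI[of _ t]) auto
      qed
    qed
  qed
  from this[OF subset_refl] obtain g where g: "g \<in> shuffle_group"
    "\<forall>R\<in>P. \<forall>s l. cell s l \<longrightarrow> rect s (s + l) \<inter> R \<noteq> {} \<longrightarrow>
      (\<exists>t. cell t l \<and> (\<forall>x\<in>rect s (s + l). g (f x) = x + (t - s)))" by (elim bexE conjE) (rule that)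
  have "g \<in> Rec_on unit_cube" using g(1) shuffle_group_subset_Rec_on by blast
  then have gf: "g \<circ> f \<in> Rec_on unit_cube" using f Rec_on_comp by blast
  have "g \<circ> f \<in> shuffle_group"
  proof (rule permutes_cells_in_shuffle_group)
    obtain k where "k \<circ> (g \<circ> f) = id" using Rec_on_left_inverse[OF gf] by blast
    then show "inj (g \<circ> f)" by (metis inj_on_id inj_on_imageI2)
    show "(g \<circ> f) x = x" if "x \<notin> unit_cube" for x using Rec_onD(1)[OF gf that] .
    show "permutes_cells (g \<circ> f)"
      unfolding permutes_cells_def
    proof (intro allI impI)
      fix s l :: "real^'n" assume c: "cell s l"
      then have "s \<in> \<Union>P" using cell_corner[OF c] cell_subset[OF c] P(2) by blast
      then obtain R where "R \<in> P" "s \<in> R" by blast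
      then have "rect s (s + l) \<inter> R \<noteq> {}" using cell_corner[OF c] by blast
      then show "\<exists>t. cell t l \<and> (\<forall>x\<in>rect s (s + l). (g \<circ> f) x = x + (t - s))"
        using g(2) \<open>R \<in> P\<close> c by simp
    qed
  qed
  then show ?thesis by (rule Rec_on_in_shuffle_group[OF f g(1)])
qed

theorem theorem1p1:
  shows "generate (Rec_group (unit_cube :: (real^'n) set)) (restricted_shuffles unit_cube)
           = carrier (Rec_group (unit_cube :: (real^'n) set))"
  using shuffle_group_subset_Rec_on Rec_on_subset_shuffle_group
  by (auto simp: shuffle_group_def Rec_group_def)

end
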